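(* The magnitude of the tope graph of a simple oriented matroid depends only on its underlying matroid; that is, if two simple oriented matroids $\mathcal M,\mathcal M'$ have the same underlying matroid, then $\operatorname{Mag}(G(\mathcal M);q)=\operatorname{Mag}(G(\mathcal M');q)$.
   Context: All oriented matroids are finite. An oriented matroid $(E,\mathcal L)$ is given by covectors $\mathcal L\subseteq\{+,0,-\}^E$ containing $0$, closed under negation and composition ($(X\circ Y)_e=X_e$ if $X_e\ne0$, else $Y_e$), and satisfying strong elimination: if $X,Y\in\mathcal L$ and $e\in S(X,Y)=\{e:X_e=-Y_e\neq0\}$, there is $Z\in\mathcal L$ with $Z_e=0$ and $Z_f=(X\circ Y)_f$ for $f\notin S(X,Y)$. The flats of its underlying matroid are the zero sets of covectors; it is simple if its underlying matroid has no loops or parallel elements. Topes are the maximal covectors ($X\le Y\iff X_e\in\{0,Y_e\}$ for all $e$). For simple $\mathcal M$, the tope graph $G(\mathcal M)$ joins topes differing in exactly one coordinate, with distance $d(B,C)=|S(B,C)|$. For a finite connected graph $G$ with distance $d$, $\operatorname{Mag}(G;q)=\mathbf 1^{\mathsf T}K_G(q)^{-1}\mathbf 1$ with $K_G(q)=(q^{d(B,C)})_{B,C\in V(G)}$. *)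

theory Defs
  imports "HOL-Computational_Algebra.Computational_Algebra"
begin

section \<open>Oriented matroids\<close>

text \<open>
  The signs \<open>+\<close>, \<open>0\<close>, \<open>-\<close> are the integers \<open>1\<close>, \<open>0\<close>, \<open>-1\<close>.  A sign vector on \<open>E\<close> is a
  function that is normalised to be \<open>0\<close> outside \<open>E\<close>, so that equality of sign vectors on \<open>E\<close>
  is equality of functions.
\<close>

definition sign_vectors :: "'a set \<Rightarrow> ('a \<Rightarrow> int) set" where
  "sign_vectors E = {X. (\<forall>e\<in>E. X e \<in> {1, 0, -1}) \<and> (\<forall>e. e \<notin> E \<longrightarrow> X e = 0)}"

definition sv_comp :: "('a \<Rightarrow> int) \<Rightarrow> ('a \<Rightarrow> int) \<Rightarrow> 'a \<Rightarrow> int" where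
  "sv_comp X Y = (\<lambda>e. if X e \<noteq> 0 then X e else Y e)"

definition sv_sep :: "('a \<Rightarrow> int) \<Rightarrow> ('a \<Rightarrow> int) \<Rightarrow> 'a set" where
  "sv_sep X Y = {e. X e = - Y e \<and> X e \<noteq> 0}"

definition sv_le :: "('a \<Rightarrow> int) \<Rightarrow> ('a \<Rightarrow> int) \<Rightarrow> bool" where
  "sv_le X Y \<longleftrightarrow> (\<forall>e. X e \<in> {0, Y e})"

locale oriented_matroid =
  fixes E :: "'a set" and L :: "('a \<Rightarrow> int) set"
  assumes finite_ground: "finite E"
    and covectors_sign: "L \<subseteq> sign_vectors E"
    and zero_covector: "(\<lambda>e. 0) \<in> L"
    and neg_covector: "X \<in> L \<Longrightarrow> (\<lambda>e. - X e) \<in> L"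
    and comp_covector: "X \<in> L \<Longrightarrow> Y \<in> L \<Longrightarrow> sv_comp X Y \<in> L"
    and strong_elim: "X \<in> L \<Longrightarrow> Y \<in> L \<Longrightarrow> e \<in> sv_sep X Y \<Longrightarrow>
      \<exists>Z\<in>L. Z e = 0 \<and> (\<forall>f\<in>E - sv_sep X Y. Z f = sv_comp X Y f)"


section \<open>The underlying matroid\<close>

text \<open>A matroid is represented by its ground set together with its set of flats.\<close>

type_synonym 'a flat_matroid = "'a set \<times> 'a set set"

definition matroid_closure :: "'a flat_matroid \<Rightarrow> 'a set \<Rightarrow> 'a set" where
  "matroid_closure M A = \<Inter> {F \<in> snd M. A \<subseteq> F}"

definition matroid_indep :: "'a flat_matroid \<Rightarrow> 'a set \<Rightarrow> bool" where
  "matroid_indep M A \<longleftrightarrow> A \<subseteq> fst M \<and> (\<forall>e\<in>A. e \<notin> matroid_closure M (A - {e}))"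

definition matroid_circuit :: "'a flat_matroid \<Rightarrow> 'a set \<Rightarrow> bool" where
  "matroid_circuit M C \<longleftrightarrow>
     C \<subseteq> fst M \<and> \<not> matroid_indep M C \<and> (\<forall>D. D \<subset> C \<longrightarrow> matroid_indep M D)"

definition matroid_loop :: "'a flat_matroid \<Rightarrow> 'a \<Rightarrow> bool" where
  "matroid_loop M e \<longleftrightarrow> matroid_circuit M {e}"

definition matroid_parallel :: "'a flat_matroid \<Rightarrow> 'a \<Rightarrow> 'a \<Rightarrow> bool" where
  "matroid_parallel M e f \<longleftrightarrow> e \<noteq> f \<and> matroid_circuit M {e, f}"

definition simple_matroid :: "'a flat_matroid \<Rightarrow> bool" where
  "simple_matroid M \<longleftrightarrow> (\<forall>e. \<not> matroid_loop M e) \<and> (\<forall>e f. \<not> matroid_parallel M e f)"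

definition zero_set :: "'a set \<Rightarrow> ('a \<Rightarrow> int) \<Rightarrow> 'a set" where
  "zero_set E X = {e \<in> E. X e = 0}"

definition underlying_matroid :: "'a set \<Rightarrow> ('a \<Rightarrow> int) set \<Rightarrow> 'a flat_matroid" where
  "underlying_matroid E L = (E, zero_set E ` L)"

locale simple_oriented_matroid = oriented_matroid +
  assumes simple_underlying: "simple_matroid (underlying_matroid E L)"


section \<open>Magnitude of a finite connected graph\<close>

text \<open>A graph is a set of vertices together with a symmetric relation of adjacency on it.\<close>

type_synonym 'v graph = "'v set \<times> ('v \<times> 'v) set"

text \<open>
  The length of a shortest path: \<^term>\<open>R ^^ n\<close> relates the endpoints of walks of length \<open>n\<close>.
  The value is meaningful only for vertices in the same connected component.
\<close>

definition graph_dist :: "'v graph \<Rightarrow> 'v \<Rightarrow> 'v \<Rightarrow> nat" where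
  "graph_dist G u v = (LEAST n. (u, v) \<in> snd G ^^ n)"

text \<open>
  The two-sided inverse of a square matrix with rows and columns indexed by the finite set \<open>V\<close>.
\<close>

definition is_inverse_on ::
    "'v set \<Rightarrow> ('v \<Rightarrow> 'v \<Rightarrow> 'k::field) \<Rightarrow> ('v \<Rightarrow> 'v \<Rightarrow> 'k) \<Rightarrow> bool" where
  "is_inverse_on V A B \<longleftrightarrow>
     (\<forall>u\<in>V. \<forall>w\<in>V. (\<Sum>v\<in>V. A u v * B v w) = (if u = w then 1 else 0)) \<and>
     (\<forall>u\<in>V. \<forall>w\<in>V. (\<Sum>v\<in>V. B u v * A v w) = (if u = w then 1 else 0))"

definition inverse_on :: "'v set \<Rightarrow> ('v \<Rightarrow> 'v \<Rightarrow> 'k::field) \<Rightarrow> 'v \<Rightarrow> 'v \<Rightarrow> 'k" where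
  "inverse_on V A = (SOME B. is_inverse_on V A B)"

text \<open>
  \<open>q\<close> is the indeterminate of the field of rational functions over the rational numbers.  The
  matrix \<open>K\<close> has entry \<open>1\<close> on the diagonal and positive powers of \<open>q\<close> elsewhere, so its
  determinant is a polynomial with constant coefficient \<open>1\<close>; hence \<open>K\<close> is invertible over this
  field, and its inverse is unique as far as indices in the vertex set are concerned.
\<close>

definition mag_q :: "rat poly fract" where
  "mag_q = to_fract [:0, 1:]"

definition similarity_matrix :: "'v graph \<Rightarrow> 'v \<Rightarrow> 'v \<Rightarrow> rat poly fract" where
  "similarity_matrix G B C = mag_q ^ graph_dist G B C"

definition magnitude :: "'v graph \<Rightarrow> rat poly fract" where
  "magnitude G = (\<Sum>B\<in>fst G. \<Sum>C\<in>fst G. inverse_on (fst G) (similarity_matrix G) B C)"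


section \<open>The tope graph\<close>

definition topes :: "('a \<Rightarrow> int) set \<Rightarrow> ('a \<Rightarrow> int) set" where
  "topes L = {T \<in> L. \<forall>X\<in>L. sv_le T X \<longrightarrow> X = T}"

definition tope_graph :: "('a \<Rightarrow> int) set \<Rightarrow> ('a \<Rightarrow> int) graph" where
  "tope_graph L =
     (topes L, {(B, C). B \<in> topes L \<and> C \<in> topes L \<and> card {e. B e \<noteq> C e} = 1})"

end

(*
  Write rho(Z) = (-1)^(rank Z); this depends only on the matroid.  For a tope B of an oriented
  matroid on n elements,

    sum over the covectors F of  rho(zero set of F) * q^|S(B,F)|  =  q^n.

  For F <> 0 the topes above F form a gated set isomorphic to the topes of the restriction to the
  zero set of F, so |S(B,C)| splits through F o B for every C in it.  Hence the sum over F <> 0 of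
  rho(zero set of F) times the weighting of that restriction has the constant transform
  q^n - rho(E), and dividing by this constant gives a weighting.  The magnitude is therefore
  determined recursively by rho and by the numbers of covectors with a given zero set, and these
  numbers are determined by rho through the identity at q = 1, applied to contractions.
*)

theory Submission
  imports Defs "Jordan_Normal_Form.Determinant"
begin

section \<open>Minors of oriented matroids\<close>

text \<open>The identity for a tope packs together the Euler relations of all restrictions:
  \<open>q ^ card (sv_sep B F)\<close> expands in powers of \<open>1 / q - 1\<close> over the sets
  \<open>A\<close> that \<open>sv_sep B F\<close> avoids, and the coefficient of \<open>A\<close> is
  the alternating sum over the faces of \<open>B\<close> restricted to \<open>A\<close>, which
  vanishes unless \<open>A\<close> is empty. These relations rest on one fact: summing
  \<open>\<rho> (zero_set E F)\<close> over the fibres of a deletion gives the same weight on the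
  deletion. Only the parity of the rank enters, so \<open>\<rho>\<close> is any function obeying a
  local rule for adding one element, and this rule passes to minors. Both oriented matroids are
  given the same \<open>\<rho>\<close>; this is how dependence on the flats alone is
  expressed.\<close>

lemma finite_sign_vectors: "finite E \<Longrightarrow> finite (sign_vectors E)"
  by (rule finite_subset[OF _ finite_set_of_finite_funs[of E "{1, 0, -1}" 0]])
    (auto simp: sign_vectors_def)

text \<open>Extension by zero keeps the normal form of sign vectors, so the image of
  \<open>L\<close> under \<open>res D\<close> is the covector set of the restriction to
  \<open>D\<close>, that is, of the deletion of \<open>E - D\<close>.\<close>

definition res :: "'a set \<Rightarrow> ('a \<Rightarrow> int) \<Rightarrow> 'a \<Rightarrow> int" where
  "res D F = (\<lambda>e. if e \<in> D then F e else 0)"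

lemma res_apply [simp]: "e \<in> D \<Longrightarrow> res D F e = F e" "e \<notin> D \<Longrightarrow> res D F e = 0"
  by (simp_all add: res_def)

lemma res_res [simp]: "D \<subseteq> A \<Longrightarrow> res D (res A F) = res D F"
  by (auto simp: res_def fun_eq_iff)

lemma res_image_res [simp]: "D \<subseteq> A \<Longrightarrow> res D ` res A ` L = res D ` L"
  by (simp add: image_image)

lemma res_empty [simp]: "res {} F = (\<lambda>e. 0)"
  by (simp add: res_def)

context oriented_matroid
begin

lemma covector_values: "X \<in> L \<Longrightarrow> X e \<in> {1, 0, -1}"
  using covectors_sign by (cases "e \<in> E") (auto simp: sign_vectors_def)

lemma covector_off: "X \<in> L \<Longrightarrow> e \<notin> E \<Longrightarrow> X e = 0"
  using covectors_sign by (auto simp: sign_vectors_def)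

lemma finite_covectors: "finite L"
  using finite_subset[OF covectors_sign finite_sign_vectors[OF finite_ground]] .

lemma res_ground: "X \<in> L \<Longrightarrow> res E X = X"
  by (auto simp: res_def fun_eq_iff covector_off)

lemma res_image_ground: "res E ` L = L"
  using res_ground by force

lemma oriented_matroid_res:
  assumes "D \<subseteq> E"
  shows "oriented_matroid D (res D ` L)"
proof
  show "finite D" using assms finite_ground by (rule finite_subset)
  show "res D ` L \<subseteq> sign_vectors D"
  proof
    fix X assume "X \<in> res D ` L"
    then obtain F where "F \<in> L" "X = res D F" by auto
    then show "X \<in> sign_vectors D" using covector_values[of F] by (simp add: sign_vectors_def)
  qed
  show "(\<lambda>e. 0) \<in> res D ` L"
    using zero_covector by (auto simp: res_def fun_eq_iff intro!: image_eqI)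
next
  fix X assume "X \<in> res D ` L"
  then obtain F where "F \<in> L" "X = res D F" by auto
  then show "(\<lambda>e. - X e) \<in> res D ` L"
    by (auto intro!: image_eqI[OF _ neg_covector[of F]] simp: res_def)
next
  fix X Y assume "X \<in> res D ` L" "Y \<in> res D ` L"
  then obtain F G where FG: "F \<in> L" "X = res D F" "G \<in> L" "Y = res D G" by auto
  then show "sv_comp X Y \<in> res D ` L"
    by (auto intro!: image_eqI[OF _ comp_covector[of F G]] simp: res_def sv_comp_def)
  fix e assume e: "e \<in> sv_sep X Y"
  with FG have eD: "e \<in> D" "e \<in> sv_sep F G"
    by (auto simp: sv_sep_def res_def split: if_splits)
  then obtain Z where Z: "Z \<in> L" "Z e = 0" "\<forall>f\<in>E - sv_sep F G. Z f = sv_comp F G f"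
    using strong_elim FG by blast
  have "res D Z f = sv_comp X Y f" if "f \<in> D - sv_sep X Y" for f
    using that Z(3) assms FG by (auto simp: sv_sep_def sv_comp_def)
  with Z eD show "\<exists>Z\<in>res D ` L. Z e = 0 \<and> (\<forall>f\<in>D - sv_sep X Y. Z f = sv_comp X Y f)"
    by (intro bexI[of _ "res D Z"]) auto
qed

lemma oriented_matroid_contract: "oriented_matroid (E - {e}) {F \<in> L. F e = 0}"
proof
  show "finite (E - {e})" using finite_ground by simp
  show "{F \<in> L. F e = 0} \<subseteq> sign_vectors (E - {e})"
    using covectors_sign by (auto simp: sign_vectors_def)
  show "(\<lambda>e. 0) \<in> {F \<in> L. F e = 0}" using zero_covector by simp
next
  fix X assume "X \<in> {F \<in> L. F e = 0}"
  then show "(\<lambda>e. - X e) \<in> {F \<in> L. F e = 0}" using neg_covector by simp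
next
  fix X Y assume XY: "X \<in> {F \<in> L. F e = 0}" "Y \<in> {F \<in> L. F e = 0}"
  then show "sv_comp X Y \<in> {F \<in> L. F e = 0}"
    using comp_covector by (simp add: sv_comp_def)
  fix f assume f: "f \<in> sv_sep X Y"
  then obtain Z where Z: "Z \<in> L" "Z f = 0" "\<forall>g\<in>E - sv_sep X Y. Z g = sv_comp X Y g"
    using strong_elim XY by blast
  have "Z e = 0"
    using Z XY covector_off by (cases "e \<in> E") (auto simp: sv_sep_def sv_comp_def)
  with Z show "\<exists>Z\<in>{F \<in> L. F e = 0}. Z f = 0 \<and> (\<forall>g\<in>E - {e} - sv_sep X Y. Z g = sv_comp X Y g)"
    by (intro bexI[of _ Z]) auto
qed

end


section \<open>The sign of the rank\<close>

text \<open>Up to a global factor, such a function is \<open>(-1)\<close> to the power of the rank of its argument.\<close>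

definition rank_sign :: "'a flat_matroid \<Rightarrow> ('a set \<Rightarrow> int) \<Rightarrow> bool" where
  "rank_sign M \<rho> \<longleftrightarrow> (\<forall>Z e. Z \<subseteq> fst M \<longrightarrow> e \<in> fst M - Z \<longrightarrow>
     \<rho> (insert e Z) = (if \<forall>F\<in>snd M. Z \<subseteq> F \<longrightarrow> e \<in> F then \<rho> Z else - \<rho> Z))"

lemma rank_sign_iff:
  "rank_sign (underlying_matroid E L) \<rho> \<longleftrightarrow> (\<forall>Z e. Z \<subseteq> E \<longrightarrow> e \<in> E - Z \<longrightarrow>
     \<rho> (insert e Z) = (if \<forall>X\<in>L. (\<forall>z\<in>Z. X z = 0) \<longrightarrow> X e = 0 then \<rho> Z else - \<rho> Z))"
proof -
  have "(\<forall>F\<in>snd (underlying_matroid E L). Z \<subseteq> F \<longrightarrow> e \<in> F) \<longleftrightarrow>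
      (\<forall>X\<in>L. (\<forall>z\<in>Z. X z = 0) \<longrightarrow> X e = 0)" if "Z \<subseteq> E" "e \<in> E - Z" for Z e
    using that by (auto simp: underlying_matroid_def zero_set_def subset_iff)
  then show ?thesis by (simp add: rank_sign_def underlying_matroid_def cong: imp_cong)
qed

lemma rank_sign_indep:
  assumes "rank_sign (underlying_matroid E L) \<rho>" "Z \<subseteq> E" "e \<in> E" "e \<notin> Z"
    and "X \<in> L" "\<And>z. z \<in> Z \<Longrightarrow> X z = 0" "X e \<noteq> 0"
  shows "\<rho> (insert e Z) = - \<rho> Z"
  using assms unfolding rank_sign_iff by auto

lemma rank_sign_dep:
  assumes "rank_sign (underlying_matroid E L) \<rho>" "Z \<subseteq> E" "e \<in> E" "e \<notin> Z"
    and "\<And>X. X \<in> L \<Longrightarrow> (\<And>z. z \<in> Z \<Longrightarrow> X z = 0) \<Longrightarrow> X e = 0"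
  shows "\<rho> (insert e Z) = \<rho> Z"
  using assms unfolding rank_sign_iff by auto

lemma rank_sign_res:
  assumes "rank_sign (underlying_matroid E L) \<rho>" "D \<subseteq> E"
  shows "rank_sign (underlying_matroid D (res D ` L)) \<rho>"
  unfolding rank_sign_iff
proof (intro allI impI)
  fix Z e assume Ze: "Z \<subseteq> D" "e \<in> D - Z"
  then have "(\<forall>X\<in>res D ` L. (\<forall>z\<in>Z. X z = 0) \<longrightarrow> X e = 0) \<longleftrightarrow>
      (\<forall>X\<in>L. (\<forall>z\<in>Z. X z = 0) \<longrightarrow> X e = 0)"
    by (auto simp: subset_iff)
  moreover have "\<rho> (insert e Z) = (if \<forall>X\<in>L. (\<forall>z\<in>Z. X z = 0) \<longrightarrow> X e = 0 then \<rho> Z else - \<rho> Z)"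
    using assms Ze unfolding rank_sign_iff by blast
  ultimately show "\<rho> (insert e Z) =
      (if \<forall>X\<in>res D ` L. (\<forall>z\<in>Z. X z = 0) \<longrightarrow> X e = 0 then \<rho> Z else - \<rho> Z)"
    by simp
qed

text \<open>The rank of \<open>Z\<close> in the contraction is the rank of \<open>insert e Z\<close>
  minus that of \<open>{e}\<close>. The shifted function therefore obeys the rule only up to the
  factor \<open>\<rho> {e}\<close>, which is why \<open>rank_sign\<close> prescribes no value at the
  empty set.\<close>

lemma rank_sign_contract:
  assumes "rank_sign (underlying_matroid E L) \<rho>" "e \<in> E"
  shows "rank_sign (underlying_matroid (E - {e}) {F \<in> L. F e = 0}) (\<lambda>Z. \<rho> (insert e Z))"
  unfolding rank_sign_iff
proof (intro allI impI)
  fix Z f assume Zf: "Z \<subseteq> E - {e}" "f \<in> E - {e} - Z"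
  then have "insert e Z \<subseteq> E" "f \<in> E - insert e Z" using assms(2) by auto
  then have "\<rho> (insert f (insert e Z)) = (if \<forall>X\<in>L. (\<forall>z\<in>insert e Z. X z = 0) \<longrightarrow> X f = 0
      then \<rho> (insert e Z) else - \<rho> (insert e Z))"
    using assms(1) unfolding rank_sign_iff by blast
  then show "\<rho> (insert e (insert f Z)) = (if \<forall>X\<in>{F \<in> L. F e = 0}. (\<forall>z\<in>Z. X z = 0) \<longrightarrow> X f = 0
      then \<rho> (insert e Z) else - \<rho> (insert e Z))"
    by (auto simp: insert_commute)
qed

lemma rank_sign_unit:
  assumes "rank_sign M \<rho>" "\<rho> {} = 1" "finite Z" "Z \<subseteq> fst M"
  shows "\<rho> Z = 1 \<or> \<rho> Z = -1"
  using assms(3,4)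
proof (induction Z)
  case (insert e Z)
  then have "\<rho> (insert e Z) = \<rho> Z \<or> \<rho> (insert e Z) = - \<rho> Z"
    using assms(1) unfolding rank_sign_def by (metis DiffI insert_subset)
  with insert show ?case by auto
qed (use assms in auto)

context oriented_matroid
begin

text \<open>This is the Mac Lane-Steinitz exchange property of the closure operator. If
  \<open>Y f\<close> were nonzero, eliminating \<open>f\<close> between \<open>X\<close> and a
  suitably signed \<open>Y\<close> would give a covector that vanishes on \<open>D\<close> and
  \<open>f\<close> but keeps the value \<open>X e\<close>, since \<open>Y e = 0\<close>.\<close>

lemma exchange:
  assumes "X \<in> L" "\<forall>d\<in>D. X d = 0" "X e \<noteq> 0"
    and "\<And>Y. Y \<in> L \<Longrightarrow> \<forall>d\<in>insert f D. Y d = 0 \<Longrightarrow> Y e = 0"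
    and "Y \<in> L" "\<forall>d\<in>insert e D. Y d = 0"
  shows "Y f = 0"
proof (rule ccontr)
  assume Yf: "Y f \<noteq> 0"
  have Xf: "X f \<noteq> 0" using assms(1-4) by auto
  define Y' where "Y' = (if Y f = - X f then Y else (\<lambda>e. - Y e))"
  have Y': "Y' \<in> L" "\<forall>d\<in>insert e D. Y' d = 0"
    using assms(5,6) neg_covector by (auto simp: Y'_def)
  have "Y' f = - X f"
    using Yf Xf covector_values[OF assms(1), of f] covector_values[OF assms(5), of f]
    by (auto simp: Y'_def)
  then have "f \<in> sv_sep X Y'" using Xf by (simp add: sv_sep_def)
  then obtain Z where Z: "Z \<in> L" "Z f = 0" "\<forall>g\<in>E - sv_sep X Y'. Z g = sv_comp X Y' g"
    using strong_elim assms(1) Y'(1) by blast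
  have "Z d = sv_comp X Y' d" if "d \<in> insert e D" for d
  proof (cases "d \<in> E")
    case True
    then show ?thesis using that Y' assms(2,3) Z(3) by (auto simp: sv_sep_def)
  next
    case False
    then show ?thesis using covector_off[OF Z(1)] covector_off[OF assms(1)] covector_off[OF Y'(1)]
      by (simp add: sv_comp_def)
  qed
  then have "\<forall>d\<in>insert f D. Z d = 0" "Z e = X e"
    using Z(2) assms(2,3) Y'(2) by (auto simp: sv_comp_def)
  then show False using assms(3) assms(4)[OF Z(1)] by simp
qed

text \<open>By the exchange property, adding the elements of a set one at a time and recording the sign
  of the rank gives a result that does not depend on their order.\<close>

lemma rank_sign_exists: "\<exists>\<rho>. rank_sign (underlying_matroid E L) \<rho> \<and> \<rho> {} = 1"
proof -
  define dep where "dep D e \<longleftrightarrow> (\<forall>X\<in>L. (\<forall>d\<in>D. X d = 0) \<longrightarrow> X e = 0)" for D e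
  define h :: "'a \<Rightarrow> 'a set \<times> int \<Rightarrow> 'a set \<times> int" where
    "h e = (\<lambda>(D, s). (insert e D, if dep D e then s else - s))" for e
  have fst_h: "fst (h e p) = insert e (fst p)" for e p
    by (simp add: h_def split: prod.split)
  have snd_h: "snd (h e p) = (if dep (fst p) e then snd p else - snd p)" for e p
    by (simp add: h_def split: prod.split)
  have mono: "dep D e \<Longrightarrow> dep (insert f D) e" for D e f by (auto simp: dep_def)
  have exch: "dep (insert e D) f" if "\<not> dep D e" "dep (insert f D) e" for D e f
  proof -
    obtain X where X: "X \<in> L" "\<forall>d\<in>D. X d = 0" "X e \<noteq> 0" using \<open>\<not> dep D e\<close> by (auto simp: dep_def)
    show ?thesis unfolding dep_def
      using exchange[OF X] \<open>dep (insert f D) e\<close> unfolding dep_def by blast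
  qed
  have trans: "dep D e" if "dep D f" "dep (insert f D) e" for D e f
    using that by (auto simp: dep_def)
  interpret comp_fun_commute h
  proof
    fix e f
    have "h e (h f (D, s)) = h f (h e (D, s))" for D s
    proof -
      \<comment> \<open>Both sides record the parity of the rank gained by adding \<open>e\<close>
        and \<open>f\<close> to \<open>D\<close>. If exactly one of them depends on
        \<open>D\<close>, transitivity and monotonicity give one sign change on each side; if
        neither does, exchange makes the two second steps agree.\<close>
      have "(if dep (insert f D) e then if dep D f then s else - s else - (if dep D f then s else - s)) =
          (if dep (insert e D) f then if dep D e then s else - s else - (if dep D e then s else - s))"
        using mono[of D e f] mono[of D f e] exch[of D e f] exch[of D f e] trans[of D e f] trans[of D f e]
        by (smt (verit))
      then show ?thesis by (simp only: h_def prod.case insert_commute)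
    qed
    then show "h e \<circ> h f = h f \<circ> h e" by (auto simp: fun_eq_iff)
  qed
  define \<rho> where "\<rho> Z = snd (Finite_Set.fold h ({}, 1) Z)" for Z
  have fst_fold: "fst (Finite_Set.fold h ({}, 1) Z) = Z" if "finite Z" for Z
    using that by (induction Z) (auto simp: fst_h)
  have "\<rho> (insert e Z) = (if dep Z e then \<rho> Z else - \<rho> Z)" if "finite Z" "e \<notin> Z" for e Z
    using that by (simp add: \<rho>_def snd_h fst_fold)
  moreover have "finite Z" if "Z \<subseteq> E" for Z using that finite_ground by (rule finite_subset)
  ultimately have "rank_sign (underlying_matroid E L) \<rho>"
    unfolding rank_sign_iff dep_def by blast
  moreover have "\<rho> {} = 1" by (simp add: \<rho>_def)
  ultimately show ?thesis by blast
qed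


section \<open>Euler relations\<close>

text \<open>The fibre of \<open>G\<close> under the deletion of \<open>e\<close> has the values \<open>{+}\<close>, \<open>{-}\<close>, \<open>{0}\<close> or
  \<open>{+, 0, -}\<close> at \<open>e\<close>, and \<open>e\<close> depends on the zero set of \<open>G\<close> just when \<open>0\<close> is the only value.\<close>

lemma fibre_sum:
  assumes rs: "rank_sign (underlying_matroid E L) \<rho>" and e: "e \<in> E"
    and G: "G \<in> res (E - {e}) ` L"
  shows "(\<Sum>F | F \<in> L \<and> res (E - {e}) F = G. \<rho> (zero_set E F)) = \<rho> (zero_set (E - {e}) G)"
proof -
  define Z where "Z = zero_set (E - {e}) G"
  define up where "up v = G(e := v)" for v
  have G_off: "G f = 0" if "f \<notin> E - {e}" for f using G that by auto
  have G_val: "G f \<in> {1, 0, -1}" for f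
  proof -
    obtain F where "F \<in> L" "G = res (E - {e}) F" using G by auto
    then show ?thesis using covector_values[of F f] by (simp add: res_def)
  qed
  have up_res: "F = up (F e)" if "F \<in> L" "res (E - {e}) F = G" for F
  proof
    show "F f = up (F e) f" for f
      using that(2)[symmetric] covector_off[OF that(1), of f] by (auto simp: up_def res_def)
  qed
  have res_up: "res (E - {e}) (up v) = G" for v
    using G_off by (auto simp: up_def fun_eq_iff res_def)
  have inj: "inj_on up {1, 0, -1}"
    by (auto simp: inj_on_def up_def fun_eq_iff)
  have fibre: "{F. F \<in> L \<and> res (E - {e}) F = G} = up ` {v \<in> {1, 0, -1}. up v \<in> L}"
  proof (rule Set.set_eqI)
    fix F
    show "F \<in> {F. F \<in> L \<and> res (E - {e}) F = G} \<longleftrightarrow> F \<in> up ` {v \<in> {1, 0, -1}. up v \<in> L}"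
      using up_res[of F] covector_values[of F e] res_up by auto
  qed
  have nonempty: "up 1 \<in> L \<or> up 0 \<in> L \<or> up (-1) \<in> L"
  proof -
    obtain F where "F \<in> L" "res (E - {e}) F = G" using G by auto
    then show ?thesis using up_res[of F] covector_values[of F e] by auto
  qed
  \<comment> \<open>Where \<open>G\<close> is nonzero, composition ignores \<open>X\<close>; on
    \<open>Z\<close> both vanish. Only the value at \<open>e\<close> can be new.\<close>
  have extend: "up (X e) \<in> L" if "up 0 \<in> L" "X \<in> L" "\<And>z. z \<in> Z \<Longrightarrow> X z = 0" for X
  proof -
    have "sv_comp (up 0) X = up (X e)"
    proof
      fix f
      show "sv_comp (up 0) X f = up (X e) f"
        using that covector_off[OF that(2), of f]
        by (cases "f \<in> E") (auto simp: sv_comp_def up_def Z_def zero_set_def)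
    qed
    then show ?thesis using comp_covector[OF that(1,2)] by simp
  qed
  have elim: "up 0 \<in> L" if up: "up 1 \<in> L" "up (-1) \<in> L"
  proof -
    have "e \<in> sv_sep (up 1) (up (-1))" by (simp add: sv_sep_def up_def)
    then obtain X where X: "X \<in> L" "X e = 0"
        "\<forall>f\<in>E - sv_sep (up 1) (up (-1)). X f = sv_comp (up 1) (up (-1)) f"
      using strong_elim up by blast
    have "X f = up 0 f" for f
      using X G_off[of f] covector_off[OF X(1), of f]
      by (cases "f \<in> E - {e}") (auto simp: up_def sv_sep_def sv_comp_def)
    then have "X = up 0" by (rule ext)
    with X(1) show ?thesis by simp
  qed
  have flip: "up (- v) \<in> L" if "up 0 \<in> L" "up v \<in> L" for v
    using extend[OF that(1) neg_covector[OF that(2)]]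
    by (auto simp: up_def Z_def zero_set_def split: if_splits)
  have Z: "Z \<subseteq> E" "e \<notin> Z" by (auto simp: Z_def zero_set_def)
  have indep: "\<rho> (insert e Z) = - \<rho> Z" if "up 1 \<in> L"
    using rank_sign_indep[OF rs Z(1) e Z(2) that] by (auto simp: up_def Z_def zero_set_def)
  have dep: "\<rho> (insert e Z) = \<rho> Z" if "up 0 \<in> L" "up 1 \<notin> L"
  proof (rule rank_sign_dep[OF rs Z(1) e Z(2)])
    fix X assume X: "X \<in> L" "\<And>z. z \<in> Z \<Longrightarrow> X z = 0"
    show "X e = 0"
      using extend[OF that(1) X] flip[OF that(1), of "-1"] that(2) covector_values[OF X(1), of e]
      by auto
  qed
  have zero_up: "zero_set E (up v) = (if v = 0 then insert e Z else Z)" for v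
    using e by (auto simp: zero_set_def up_def Z_def)
  have "(\<Sum>F | F \<in> L \<and> res (E - {e}) F = G. \<rho> (zero_set E F)) =
      (\<Sum>v\<in>{v \<in> {1, 0, -1}. up v \<in> L}. \<rho> (zero_set E (up v)))"
    unfolding fibre by (rule sum.reindex[unfolded o_def]) (rule inj_on_subset[OF inj], auto)
  also have "\<dots> = (\<Sum>v\<in>{1, 0, -1}. if up v \<in> L then \<rho> (zero_set E (up v)) else 0)"
    by (subst sum.inter_filter) auto
  \<comment> \<open>A fibre \<open>{+}\<close> or \<open>{-}\<close> gives \<open>\<rho> Z\<close>
    directly, a fibre \<open>{0}\<close> gives it by dependence, and \<open>{+, 0, -}\<close> gives
    \<open>\<rho> Z - \<rho> Z + \<rho> Z\<close>.\<close>
  also have "\<dots> = \<rho> Z"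
    using nonempty elim flip[of 1] flip[of "-1"] indep dep by (auto simp: zero_up)
  finally show ?thesis by (simp add: Z_def)
qed

end

text \<open>Deleting one element at a time, each step collapses whole fibres by
  \<open>fibre_sum\<close>. The condition \<open>P\<close> looks only at the restriction to
  \<open>D\<close>, so it never cuts a fibre.\<close>

lemma deletion_sum:
  assumes "oriented_matroid E L" "rank_sign (underlying_matroid E L) \<rho>" "D \<subseteq> E"
  shows "(\<Sum>F | F \<in> L \<and> P (res D F). \<rho> (zero_set E F)) =
    (\<Sum>G | G \<in> res D ` L \<and> P G. \<rho> (zero_set D G))"
  using assms
proof (induction "card (E - D)" arbitrary: E L)
  case 0
  interpret oriented_matroid E L by fact
  have "D = E" using 0 finite_ground by auto
  then show ?case using res_ground by (auto simp: res_image_ground intro!: sum.cong)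
next
  case (Suc n)
  interpret oriented_matroid E L by fact
  obtain e where e: "e \<in> E - D" using Suc.hyps(2) by (metis all_not_in_conv card.empty nat.distinct(1))
  let ?L = "res (E - {e}) ` L"
  have D: "D \<subseteq> E - {e}" using e Suc.prems(3) by auto
  have "n = card (E - {e} - D)"
  proof -
    have "E - {e} - D = (E - D) - {e}" by auto
    then show ?thesis using Suc.hyps(2) e finite_ground by simp
  qed
  then have IH: "(\<Sum>F | F \<in> ?L \<and> P (res D F). \<rho> (zero_set (E - {e}) F)) =
      (\<Sum>G | G \<in> res D ` ?L \<and> P G. \<rho> (zero_set D G))"
    using Suc.hyps(1) oriented_matroid_res rank_sign_res[OF Suc.prems(2)] D by auto
  have "(\<Sum>F | F \<in> L \<and> P (res D F). \<rho> (zero_set E F)) =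
     (\<Sum>G\<in>{G. G \<in> ?L \<and> P (res D G)}.
       \<Sum>F\<in>{F. F \<in> {F. F \<in> L \<and> P (res D F)} \<and> res (E - {e}) F = G}. \<rho> (zero_set E F))"
    by (rule sum.group[symmetric]) (use finite_covectors D in auto)
  also have "\<dots> = (\<Sum>G\<in>{G. G \<in> ?L \<and> P (res D G)}.
       \<Sum>F\<in>{F. F \<in> L \<and> res (E - {e}) F = G}. \<rho> (zero_set E F))"
  proof (rule sum.cong[OF refl], rule sum.cong)
    fix G assume "G \<in> {G. G \<in> ?L \<and> P (res D G)}"
    then show "{F. F \<in> {F. F \<in> L \<and> P (res D F)} \<and> res (E - {e}) F = G} =
        {F. F \<in> L \<and> res (E - {e}) F = G}"
      using res_res[OF D] by (auto simp del: res_res) metis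
  qed simp
  also have "\<dots> = (\<Sum>G\<in>{G. G \<in> ?L \<and> P (res D G)}. \<rho> (zero_set (E - {e}) G))"
    by (rule sum.cong) (use fibre_sum[OF Suc.prems(2)] e in auto)
  finally show ?case using IH D by simp
qed

context oriented_matroid
begin

text \<open>A sign-reversing involution: toggling pairs faces whose zero sets differ exactly by
  \<open>e\<close>. In each pair the face that is nonzero at \<open>e\<close> witnesses that
  \<open>e\<close> is independent of the smaller zero set, so the two terms cancel.\<close>

lemma toggle_sum:
  assumes rs: "rank_sign (underlying_matroid E L) \<rho>" and e: "e \<in> E" "B e \<noteq> 0"
    and toggle: "\<And>F. F \<in> L \<Longrightarrow> sv_le F B \<Longrightarrow> F(e := B e - F e) \<in> L"
  shows "(\<Sum>F | F \<in> L \<and> sv_le F B. \<rho> (zero_set E F)) = 0"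
proof -
  \<comment> \<open>Below \<open>B\<close> the value at \<open>e\<close> is \<open>0\<close> or
    \<open>B e\<close>, and \<open>B e - F e\<close> swaps the two.\<close>
  define t where "t F = F(e := B e - F e)" for F
  let ?S = "{F. F \<in> L \<and> sv_le F B}"
  have t: "t F \<in> ?S" "t (t F) = F" if "F \<in> ?S" for F
    using that toggle by (auto simp: t_def sv_le_def fun_eq_iff)
  have sgn: "\<rho> (zero_set E (t F)) = - \<rho> (zero_set E F)" if "F \<in> ?S" for F
  proof (cases "F e = 0")
    case True
    then have "zero_set E F = insert e (zero_set E (t F))" using e by (auto simp: zero_set_def t_def)
    moreover have "\<rho> (insert e (zero_set E (t F))) = - \<rho> (zero_set E (t F))"
      by (rule rank_sign_indep[OF rs _ e(1), of _ "t F"])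
        (use t[OF that] True e in \<open>auto simp: zero_set_def t_def\<close>)
    ultimately show ?thesis by simp
  next
    case False
    with that have "F e = B e" by (auto simp: sv_le_def)
    then have "zero_set E (t F) = insert e (zero_set E F)" using e by (auto simp: zero_set_def t_def)
    moreover have "\<rho> (insert e (zero_set E F)) = - \<rho> (zero_set E F)"
      by (rule rank_sign_indep[OF rs _ e(1), of _ F]) (use that False in \<open>auto simp: zero_set_def\<close>)
    ultimately show ?thesis by simp
  qed
  have "(\<Sum>F\<in>?S. \<rho> (zero_set E F)) = (\<Sum>F\<in>?S. \<rho> (zero_set E (t F)))"
    by (rule sum.reindex_bij_witness[of _ t t]) (use t in auto)
  also have "\<dots> = - (\<Sum>F\<in>?S. \<rho> (zero_set E F))"
    using sgn by (simp add: sum_negf)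
  finally show ?thesis by simp
qed

text \<open>When \<open>B e\<close> is nonzero, the separation of the two covectors is
  \<open>{e}\<close>, so elimination leaves no freedom at the other elements.\<close>

lemma wall_zero:
  assumes "B \<in> L" "B(e := - B e) \<in> L" "e \<in> E"
  shows "B(e := 0) \<in> L"
proof (cases "B e = 0")
  case False
  define B' where "B' = B(e := - B e)"
  have sep: "sv_sep B B' = {e}" using False by (auto simp: sv_sep_def B'_def)
  then obtain Z where Z: "Z \<in> L" "Z e = 0" "\<forall>f\<in>E - {e}. Z f = sv_comp B B' f"
    using strong_elim[of B B' e] assms by (auto simp: B'_def)
  have "Z f = (B(e := 0)) f" for f
    using Z covector_off[OF Z(1), of f] covector_off[OF assms(1), of f]
    by (cases "f \<in> E") (auto simp: sv_comp_def B'_def)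
  then have "Z = B(e := 0)" by (rule ext)
  with Z(1) show ?thesis by simp
qed (use assms in \<open>simp add: fun_upd_idem\<close>)

lemma all_signs_below:
  assumes all: "\<And>D. D \<subseteq> E \<Longrightarrow> (\<lambda>e. if e \<in> D then - B e else B e) \<in> L"
    and F: "sv_le F B"
  shows "F \<in> L"
proof -
  have zeroed: "(\<lambda>e. if e \<in> Z then 0 else if e \<in> D then - B e else B e) \<in> L"
    if "finite Z" "Z \<subseteq> E" "D \<subseteq> E" for Z D
    using that
  proof (induction Z arbitrary: D)
    case empty
    then show ?case using all by simp
  next
    case (insert e Z)
    define X where "X D = (\<lambda>e. if e \<in> Z then 0 else if e \<in> D then - B e else B e)" for D
    \<comment> \<open>Changing the membership of \<open>e\<close> flips only the sign at
      \<open>e\<close>, so \<open>wall_zero\<close> can put a zero there. This needs the induction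
      hypothesis for both sets, hence for arbitrary \<open>D\<close>.\<close>
    let ?D = "if e \<in> D then D - {e} else insert e D"
    have "X D' \<in> L" if "D' \<subseteq> E" for D' using insert.IH[of D'] insert.prems that by (simp add: X_def)
    moreover have "?D \<subseteq> E" using insert.prems by auto
    ultimately have "X D \<in> L" "X ?D \<in> L" using insert.prems by blast+
    moreover have "X ?D = (X D)(e := - X D e)" using insert.hyps by (auto simp: X_def fun_eq_iff)
    ultimately have "(X D)(e := 0) \<in> L" using wall_zero[of "X D" e] insert.prems by auto
    moreover have "(X D)(e := 0) = (\<lambda>f. if f \<in> insert e Z then 0 else if f \<in> D then - B f else B f)"
      by (auto simp: X_def)
    ultimately show ?case by simp
  qed
  have "B \<in> L" using all[of "{}"] by simp
  have "F = (\<lambda>e. if e \<in> {e \<in> E. F e = 0} then 0 else if e \<in> {} then - B e else B e)"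
    using F covector_off[OF \<open>B \<in> L\<close>] by (auto simp: sv_le_def fun_eq_iff)
  also have "\<dots> \<in> L" by (rule zeroed) (use finite_ground in auto)
  finally show ?thesis .
qed

end

text \<open>Crossing a wall \<open>e\<close> of a tope changes the sign of the alternating sum over its faces, and the
  sum is zero if \<open>e\<close> is not a wall.  So it can be nonzero only if every sign vector is a covector,
  and then toggling one coordinate shows that it is zero.\<close>

lemma euler_relation:
  assumes "oriented_matroid E L" "rank_sign (underlying_matroid E L) \<rho>"
    and "B \<in> L" "\<And>e. e \<in> E \<Longrightarrow> B e \<noteq> 0" "E \<noteq> {}"
  shows "(\<Sum>F | F \<in> L \<and> sv_le F B. \<rho> (zero_set E F)) = 0"
  using assms
proof (induction "card E" arbitrary: E L \<rho> B rule: less_induct)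
  case less
  interpret oriented_matroid E L by fact
  note rs = less.prems(2)
  define g where "g B = (\<Sum>F | F \<in> L \<and> sv_le F B. \<rho> (zero_set E F))" for B
  \<comment> \<open>As \<open>E - {e}\<close> is nonempty, the induction hypothesis applies to both
    the deletion and the contraction of \<open>e\<close>.\<close>
  have step: "B(e := - B e) \<in> L \<and> g (B(e := - B e)) \<noteq> 0"
    if B: "B \<in> L" "\<And>e. e \<in> E \<Longrightarrow> B e \<noteq> 0" "g B \<noteq> 0" and e: "e \<in> E" and ne: "E - {e} \<noteq> {}" for B e
  proof -
    let ?E = "E - {e}" and ?B = "B(e := - B e)"
    \<comment> \<open>\<open>ok F\<close> says that \<open>F\<close> is a face of \<open>B\<close>
      after deleting \<open>e\<close>; \<open>S V\<close> further restricts its value at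
      \<open>e\<close>.\<close>
    define ok where "ok F \<longleftrightarrow> (\<forall>f\<in>?E. F f \<in> {0, B f})" for F
    define S where "S V = {F \<in> L. ok F \<and> F e \<in> V}" for V
    define s where "s A = (\<Sum>F\<in>A. \<rho> (zero_set E F))" for A
    have card: "card ?E < card E" using e finite_ground by (rule card_Diff1_less[rotated])
    have fin: "finite (S V)" for V using finite_covectors by (simp add: S_def)
    have gB: "g B = s (S {0, B e})"
    proof -
      have "sv_le F B \<longleftrightarrow> ok F \<and> F e \<in> {0, B e}" if "F \<in> L" for F
        using covector_off[OF that] covector_off[OF B(1)] by (auto simp: sv_le_def ok_def)
      then show ?thesis unfolding g_def s_def S_def by (intro sum.cong) auto
    qed
    have gB': "g ?B = s (S {0, - B e})"
    proof -
      have "sv_le F ?B \<longleftrightarrow> ok F \<and> F e \<in> {0, - B e}" if "F \<in> L" for F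
        using covector_off[OF that] covector_off[OF B(1)] by (auto simp: sv_le_def ok_def)
      then show ?thesis unfolding g_def s_def S_def by (intro sum.cong) auto
    qed
    have "s {F \<in> L. ok F} = 0"
    proof -
      have "ok F \<longleftrightarrow> sv_le (res ?E F) (res ?E B)" for F
        by (auto simp: sv_le_def ok_def res_def)
      then have "s {F \<in> L. ok F} =
          (\<Sum>F | F \<in> L \<and> sv_le (res ?E F) (res ?E B). \<rho> (zero_set E F))"
        by (simp add: s_def)
      also have "\<dots> = (\<Sum>G | G \<in> res ?E ` L \<and> sv_le G (res ?E B). \<rho> (zero_set ?E G))"
        by (rule deletion_sum[OF less.prems(1) rs]) auto
      also have "\<dots> = 0"
        by (rule less.hyps[OF card]) (use B ne oriented_matroid_res rank_sign_res[OF rs] in auto)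
      finally show ?thesis .
    qed
    moreover have "{F \<in> L. ok F} = S {0, B e} \<union> S {0, - B e}"
    proof -
      have "F e \<in> {0, B e} \<or> F e \<in> {0, - B e}" if "F \<in> L" for F
        using covector_values[OF that, of e] covector_values[OF B(1), of e] B(2)[OF e] by auto
      then show ?thesis by (auto simp: S_def)
    qed
    moreover have "S {0, B e} \<inter> S {0, - B e} = S {0}" using B(2)[OF e] by (auto simp: S_def)
    moreover have "s (S {0, B e} \<union> S {0, - B e}) + s (S {0, B e} \<inter> S {0, - B e}) =
        s (S {0, B e}) + s (S {0, - B e})"
      unfolding s_def by (rule sum.union_inter) (rule fin)+
    \<comment> \<open>The faces of the deleted tope sum to zero, and they are covered by the faces
      of \<open>B\<close> and those of \<open>?B\<close>, which overlap in the faces with value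
      \<open>0\<close> at \<open>e\<close>.\<close>
    ultimately have eq: "s (S {0}) = g B + g ?B" by (simp add: gB gB')
    have B': "?B \<in> L"
    proof (rule ccontr)
      assume "?B \<notin> L"
      \<comment> \<open>Otherwise composing \<open>F\<close> with \<open>B\<close> would produce
        \<open>?B\<close>. So if \<open>e\<close> is not a wall, \<open>g ?B\<close> equals
        \<open>s (S {0})\<close>, and \<open>eq\<close> forces \<open>g B = 0\<close>.\<close>
      have "F e \<noteq> - B e" if F: "F \<in> L" "ok F" for F
      proof
        assume Fe: "F e = - B e"
        have "sv_comp F B f = ?B f" for f
          using Fe F(2) B(2)[OF e] covector_off[OF F(1), of f]
          by (cases "f \<in> E") (auto simp: sv_comp_def ok_def)
        then have "sv_comp F B = ?B" by (rule ext)
        with comp_covector[OF F(1) B(1)] \<open>?B \<notin> L\<close> show False by simp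
      qed
      then have "S {0, - B e} = S {0}" by (auto simp: S_def)
      with eq B(3) show False by (simp add: gB')
    qed
    \<comment> \<open>If \<open>e\<close> is a wall, \<open>B(e := 0)\<close> is nowhere zero in the
      contraction, and this is its Euler sum for the shifted \<open>\<rho>\<close>. It vanishes,
      leaving \<open>g ?B = - g B\<close>.\<close>
    have "s (S {0}) = (\<Sum>F | F \<in> {F \<in> L. F e = 0} \<and> sv_le F (B(e := 0)). \<rho> (insert e (zero_set ?E F)))"
      unfolding s_def
    proof (rule sum.cong)
      have "sv_le F (B(e := 0)) \<longleftrightarrow> ok F \<and> F e = 0" if "F \<in> L" for F
        using covector_off[OF that] covector_off[OF B(1)] by (auto simp: sv_le_def ok_def)
      then show "S {0} = {F. F \<in> {F \<in> L. F e = 0} \<and> sv_le F (B(e := 0))}" by (auto simp: S_def)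
      fix F assume "F \<in> {F. F \<in> {F \<in> L. F e = 0} \<and> sv_le F (B(e := 0))}"
      then have "zero_set E F = insert e (zero_set ?E F)" using e by (auto simp: zero_set_def)
      then show "\<rho> (zero_set E F) = \<rho> (insert e (zero_set ?E F))" by simp
    qed
    also have "\<dots> = 0"
      by (rule less.hyps[OF card oriented_matroid_contract rank_sign_contract[OF rs e]])
        (use B ne wall_zero[OF B(1) B' e] in auto)
    finally show ?thesis using B' eq B(3) by auto
  qed
  obtain e where e: "e \<in> E" using less.prems(5) by auto
  note B = less.prems(3,4)
  show ?case
  proof (cases "E - {e} = {}")
    case True
    \<comment> \<open>With a single element there is no smaller nonempty ground set to induct on,
      but the faces of \<open>B\<close> are just \<open>0\<close> and \<open>B\<close>, swapped by
      toggling.\<close>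
    show ?thesis
    proof (rule toggle_sum[where B = B, OF rs e B(2)[OF e]])
      fix F assume F: "F \<in> L" "sv_le F B"
      have "(F(e := B e - F e)) f = (if F e = 0 then B else (\<lambda>e. 0)) f" for f
      proof (cases "f = e")
        case False
        then have "f \<notin> E" using True by auto
        then show ?thesis using False covector_off[OF F(1)] covector_off[OF B(1)] by simp
      qed (use F(2) in \<open>auto simp: sv_le_def\<close>)
      then have "F(e := B e - F e) = (if F e = 0 then B else (\<lambda>e. 0))" by (rule ext)
      then show "F(e := B e - F e) \<in> L" using B zero_covector by simp
    qed
  next
    case False
    have ne: "E - {f} \<noteq> {}" for f using e False by auto
    define fl where "fl D = (\<lambda>e. if e \<in> D then - B e else B e)" for D
    show ?thesis
    proof (rule ccontr)
      assume nz: "\<not> ?thesis"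
      have "fl D \<in> L \<and> g (fl D) \<noteq> 0" if "finite D" "D \<subseteq> E" for D
        using that
      proof (induction D)
        case empty
        then show ?case using nz B by (simp add: fl_def g_def)
      next
        case (insert f D)
        have "(fl D)(f := - fl D f) = fl (insert f D)" using insert.hyps by (auto simp: fl_def)
        moreover have "fl D h \<noteq> 0" if "h \<in> E" for h using that B(2) by (auto simp: fl_def)
        ultimately show ?case using step[of "fl D" f] insert ne by auto
      qed
      then have all: "fl D \<in> L" if "D \<subseteq> E" for D
        using that finite_subset[OF that finite_ground] by blast
      have "F \<in> L" if "sv_le F B" for F
        by (rule all_signs_below[OF _ that]) (use all in \<open>auto simp: fl_def\<close>)
      moreover have "sv_le (F(e := B e - F e)) B" if "sv_le F B" for F
        using that by (auto simp: sv_le_def)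
      ultimately have ?thesis
        using toggle_sum[where B = B, OF rs e B(2)[OF e]] by blast
      with nz show False by simp
    qed
  qed
qed


section \<open>Sums over covectors\<close>

text \<open>Without loops these are the topes (\<open>topes_eq_full\<close>); with a loop in
  \<open>E\<close> there are none. Unlike maximality, being nonzero on the ground set visibly passes
  to restrictions.\<close>

definition full :: "'a set \<Rightarrow> ('a \<Rightarrow> int) set \<Rightarrow> ('a \<Rightarrow> int) set" where
  "full E L = {T \<in> L. \<forall>e\<in>E. T e \<noteq> 0}"

lemma power_card_eq_sum_Pow:
  fixes c :: "'k::comm_ring_1"
  assumes "finite S"
  shows "(1 + c) ^ card S = (\<Sum>A\<in>Pow S. c ^ card A)"
proof -
  have "(\<Prod>i\<in>S. c + 1) = (\<Sum>A\<in>Pow S. (\<Prod>i\<in>A. c) * (\<Prod>i\<in>S - A. 1))"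
    using assms by (rule prod_add)
  then show ?thesis by (simp add: add.commute)
qed

context oriented_matroid
begin

lemma sv_sep_ground: "X \<in> L \<Longrightarrow> sv_sep X Y \<subseteq> E"
  using covector_off[of X] by (auto simp: sv_sep_def)

lemma finite_full: "finite (full E L)"
  using finite_covectors by (simp add: full_def)

text \<open>\<open>F\<close> is unseparated from \<open>B\<close> on \<open>A\<close> exactly when
  it restricts to a face of \<open>B\<close> restricted to \<open>A\<close>. So the sum pushes
  forward to the restriction, where the Euler relation applies unless \<open>A\<close> is
  empty.\<close>

lemma avoiding_sum:
  assumes rs: "rank_sign (underlying_matroid E L) \<rho>" and B: "B \<in> full E L" and A: "A \<subseteq> E"
  shows "(\<Sum>F | F \<in> L \<and> sv_sep B F \<inter> A = {}. \<rho> (zero_set E F)) = (if A = {} then \<rho> {} else 0)"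
proof -
  have "sv_sep B F \<inter> A = {} \<longleftrightarrow> sv_le (res A F) (res A B)" if "F \<in> L" for F
  proof -
    have pointwise: "\<not> (B e = - F e \<and> B e \<noteq> 0) \<longleftrightarrow> F e \<in> {0, B e}" if "e \<in> A" for e
    proof -
      have "B e = 1 \<or> B e = -1"
        using covector_values[of B e] that A B by (auto simp: full_def)
      moreover have "F e = 1 \<or> F e = 0 \<or> F e = -1"
        using covector_values[OF \<open>F \<in> L\<close>, of e] by simp
      ultimately show ?thesis by (elim disjE) simp_all
    qed
    have "sv_sep B F \<inter> A = {} \<longleftrightarrow> (\<forall>e\<in>A. \<not> (B e = - F e \<and> B e \<noteq> 0))"
      by (auto simp: sv_sep_def)
    also have "\<dots> \<longleftrightarrow> (\<forall>e\<in>A. F e \<in> {0, B e})"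
      by (rule ball_cong[OF refl pointwise])
    also have "\<dots> \<longleftrightarrow> sv_le (res A F) (res A B)"
      by (auto simp: sv_le_def res_def)
    finally show ?thesis .
  qed
  then have "(\<Sum>F | F \<in> L \<and> sv_sep B F \<inter> A = {}. \<rho> (zero_set E F)) =
      (\<Sum>F | F \<in> L \<and> sv_le (res A F) (res A B). \<rho> (zero_set E F))"
    by (intro sum.cong) auto
  also have "\<dots> = (\<Sum>G | G \<in> res A ` L \<and> sv_le G (res A B). \<rho> (zero_set A G))"
    by (rule deletion_sum[OF oriented_matroid_axioms rs A])
  also have "\<dots> = (if A = {} then \<rho> {} else 0)"
  proof (cases "A = {}")
    case True
    then have "{G. G \<in> res A ` L \<and> sv_le G (res A B)} = {\<lambda>e. 0}"
      using zero_covector by (auto simp: sv_le_def)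
    then show ?thesis using True by (simp add: zero_set_def)
  next
    case False
    then show ?thesis
      using euler_relation[OF oriented_matroid_res[OF A] rank_sign_res[OF rs A], of "res A B"] A B
      by (auto simp: full_def)
  qed
  finally show ?thesis .
qed

text \<open>Expanding \<open>q ^ card (sv_sep B F)\<close> in terms of the sets that \<open>sv_sep B F\<close> avoids reduces the
  identity to \<open>avoiding_sum\<close>.\<close>

lemma distance_sum:
  fixes q :: "'k::field"
  assumes rs: "rank_sign (underlying_matroid E L) \<rho>" and B: "B \<in> full E L" and q: "q \<noteq> 0"
  shows "(\<Sum>F\<in>L. of_int (\<rho> (zero_set E F)) * q ^ card (sv_sep B F)) = of_int (\<rho> {}) * q ^ card E"
proof -
  \<comment> \<open>Chosen so that \<open>1 + c = 1 / q\<close>: then \<open>q ^ card S\<close> is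
    \<open>q ^ card E * (1 + c) ^ card (E - S)\<close>, and the subsets of \<open>E - S\<close> are
    the sets that \<open>S\<close> avoids.\<close>
  define c where "c = 1 / q - 1"
  have BL: "B \<in> L" using B by (simp add: full_def)
  have expand: "q ^ card (sv_sep B F) =
      q ^ card E * (\<Sum>A\<in>Pow E. if sv_sep B F \<inter> A = {} then c ^ card A else 0)" for F
  proof -
    let ?S = "sv_sep B F"
    have S: "?S \<subseteq> E" using sv_sep_ground[OF BL] .
    have "card E = card ?S + card (E - ?S)"
      using S finite_ground by (metis card_Diff_subset card_mono finite_subset le_add_diff_inverse)
    then have "q ^ card ?S = q ^ card E * (1 / q) ^ card (E - ?S)"
      using q by (simp add: power_add power_divide)
    also have "(1 / q) ^ card (E - ?S) = (\<Sum>A\<in>Pow (E - ?S). c ^ card A)"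
      using power_card_eq_sum_Pow[of "E - ?S" c] finite_ground by (simp add: c_def)
    also have "\<dots> = (\<Sum>A\<in>Pow E. if ?S \<inter> A = {} then c ^ card A else 0)"
      using finite_ground by (intro sum.mono_neutral_cong_left) auto
    finally show ?thesis .
  qed
  have "(\<Sum>F\<in>L. of_int (\<rho> (zero_set E F)) * q ^ card (sv_sep B F)) =
      q ^ card E * (\<Sum>F\<in>L. \<Sum>A\<in>Pow E. c ^ card A *
        (if sv_sep B F \<inter> A = {} then of_int (\<rho> (zero_set E F)) else 0))"
    unfolding expand sum_distrib_left by (intro sum.cong refl) auto
  also have "\<dots> = q ^ card E * (\<Sum>A\<in>Pow E. \<Sum>F\<in>L. c ^ card A *
        (if sv_sep B F \<inter> A = {} then of_int (\<rho> (zero_set E F)) else 0))"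
    by (subst sum.swap) (rule refl)
  also have "\<dots> = q ^ card E * (\<Sum>A\<in>Pow E. c ^ card A * of_int (if A = {} then \<rho> {} else 0))"
  proof (intro arg_cong2[of _ _ _ _ "(*)"] refl sum.cong)
    fix A assume A: "A \<in> Pow E"
    have "(\<Sum>F\<in>L. if sv_sep B F \<inter> A = {} then of_int (\<rho> (zero_set E F)) else 0) =
        (of_int (\<Sum>F | F \<in> L \<and> sv_sep B F \<inter> A = {}. \<rho> (zero_set E F)) :: 'k)"
      using finite_covectors by (simp add: sum.inter_filter if_distrib[of of_int] cong: if_cong)
    also have "\<dots> = of_int (if A = {} then \<rho> {} else 0)"
      using avoiding_sum[OF rs B, of A] A by simp
    finally show "(\<Sum>F\<in>L. c ^ card A * (if sv_sep B F \<inter> A = {} then of_int (\<rho> (zero_set E F)) else 0)) =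
        c ^ card A * of_int (if A = {} then \<rho> {} else 0)"
      by (simp only: sum_distrib_left[symmetric])
  qed
  also have "(\<Sum>A\<in>Pow E. c ^ card A * of_int (if A = {} then \<rho> {} else 0)) =
      (\<Sum>A\<in>Pow E. if A = {} then of_int (\<rho> {}) else 0)"
    by (intro sum.cong) auto
  also have "\<dots> = of_int (\<rho> {})"
    using finite_ground by simp
  finally show ?thesis by (simp add: mult.commute)
qed

text \<open>The covectors counted are those of the contraction of \<open>Y\<close>, that is, those
  restricting to \<open>0\<close> on \<open>Y\<close>. Pushing the sum forward to \<open>Y\<close>
  leaves the single term of the zero covector, whose zero set there is \<open>Y\<close>.\<close>

lemma zero_set_count_sum:
  assumes rs: "rank_sign (underlying_matroid E L) \<rho>" and Y: "Y \<subseteq> E"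
  shows "(\<Sum>Z | Y \<subseteq> Z \<and> Z \<subseteq> E. int (card {F \<in> L. zero_set E F = Z}) * \<rho> Z) = \<rho> Y"
proof -
  let ?S = "{F. F \<in> L \<and> res Y F = (\<lambda>e. 0)}" and ?T = "{Z. Y \<subseteq> Z \<and> Z \<subseteq> E}"
  have below: "res Y F = (\<lambda>e. 0) \<longleftrightarrow> Y \<subseteq> zero_set E F" for F
    using Y by (auto simp: res_def zero_set_def fun_eq_iff)
  have "(\<Sum>Z\<in>?T. int (card {F \<in> L. zero_set E F = Z}) * \<rho> Z) =
      (\<Sum>Z\<in>?T. \<Sum>F | F \<in> ?S \<and> zero_set E F = Z. \<rho> (zero_set E F))"
  proof (intro sum.cong refl)
    fix Z assume "Z \<in> ?T"
    then have "{F. F \<in> ?S \<and> zero_set E F = Z} = {F \<in> L. zero_set E F = Z}"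
      using below by auto
    then show "int (card {F \<in> L. zero_set E F = Z}) * \<rho> Z =
        (\<Sum>F | F \<in> ?S \<and> zero_set E F = Z. \<rho> (zero_set E F))"
      by simp
  qed
  also have "\<dots> = (\<Sum>F\<in>?S. \<rho> (zero_set E F))"
    by (rule sum.group) (use finite_covectors finite_ground below in \<open>auto simp: zero_set_def\<close>)
  also have "\<dots> = (\<Sum>G | G \<in> res Y ` L \<and> G = (\<lambda>e. 0). \<rho> (zero_set Y G))"
    by (rule deletion_sum[OF oriented_matroid_axioms rs Y])
  also have "{G. G \<in> res Y ` L \<and> G = (\<lambda>e. 0)} = {\<lambda>e. 0}"
    using oriented_matroid.zero_covector[OF oriented_matroid_res[OF Y]] by auto
  finally show ?thesis by (simp add: zero_set_def)
qed

end

text \<open>The relations of \<open>zero_set_count_sum\<close> form a triangular system with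
  diagonal entries \<open>\<rho> Y\<close>; it is solved downwards from \<open>E\<close>.\<close>

lemma zero_set_count_eq:
  assumes "oriented_matroid E L" "rank_sign (underlying_matroid E L) \<rho>"
    and "oriented_matroid E L'" "rank_sign (underlying_matroid E L') \<rho>"
    and nz: "\<And>Y. Y \<subseteq> E \<Longrightarrow> \<rho> Y \<noteq> 0" and "Y \<subseteq> E"
  shows "card {F \<in> L. zero_set E F = Y} = card {F \<in> L'. zero_set E F = Y}"
  using \<open>Y \<subseteq> E\<close>
proof (induction "card (E - Y)" arbitrary: Y rule: less_induct)
  case less
  interpret A: oriented_matroid E L by fact
  interpret B: oriented_matroid E L' by fact
  define n where "n L Z = int (card {F \<in> L. zero_set E F = Z})" for L :: "('a \<Rightarrow> int) set" and Z
  let ?T = "{Z. Y \<subset> Z \<and> Z \<subseteq> E}"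
  have T: "finite ?T" "Y \<notin> ?T" "{Z. Y \<subseteq> Z \<and> Z \<subseteq> E} = insert Y ?T"
    using A.finite_ground less.prems by auto
  have "n L Z = n L' Z" if "Z \<in> ?T" for Z
  proof -
    have "card (E - Z) < card (E - Y)"
      using that A.finite_ground by (intro psubset_card_mono) auto
    then show ?thesis using less.hyps that by (simp add: n_def)
  qed
  then have "(\<Sum>Z\<in>?T. n L Z * \<rho> Z) = (\<Sum>Z\<in>?T. n L' Z * \<rho> Z)" by simp
  moreover have "n L Y * \<rho> Y + (\<Sum>Z\<in>?T. n L Z * \<rho> Z) = \<rho> Y"
    using A.zero_set_count_sum[OF assms(2) less.prems] T by (simp add: n_def)
  moreover have "n L' Y * \<rho> Y + (\<Sum>Z\<in>?T. n L' Z * \<rho> Z) = \<rho> Y"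
    using B.zero_set_count_sum[OF assms(4) less.prems] T by (simp add: n_def)
  ultimately have "n L Y * \<rho> Y = n L' Y * \<rho> Y" by linarith
  then show ?case using nz[OF less.prems] by (simp add: n_def)
qed


section \<open>Weightings\<close>

text \<open>Distance is written as the size of the separation, so the notion applies to every
  restriction before any graph is considered. \<open>m\<close> is the total weight, the candidate
  for the magnitude.\<close>

definition has_weighting :: "'a set \<Rightarrow> ('a \<Rightarrow> int) set \<Rightarrow> 'k::field \<Rightarrow> 'k \<Rightarrow> bool" where
  "has_weighting E L q m \<longleftrightarrow>
     (\<exists>w. (\<forall>B\<in>full E L. (\<Sum>C\<in>full E L. q ^ card (sv_sep B C) * w C) = 1) \<and>
       (\<Sum>C\<in>full E L. w C) = m)"

context oriented_matroid
begin

text \<open>A full covector above \<open>G\<close> is fixed by \<open>G\<close> off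
  \<open>Z\<close>; its values on \<open>Z\<close> are free up to lifting to some covector, and
  composing \<open>G\<close> with that lift realises them.\<close>

lemma star_bij:
  assumes "G \<in> L"
  defines "Z \<equiv> zero_set E G"
  shows "bij_betw (res Z) {C \<in> full E L. sv_le G C} (full Z (res Z ` L))"
proof (rule bij_betw_byWitness[where f' = "sv_comp G"])
  have Z: "e \<in> Z \<longleftrightarrow> e \<in> E \<and> G e = 0" for e by (auto simp: Z_def zero_set_def)
  show "\<forall>C\<in>{C \<in> full E L. sv_le G C}. sv_comp G (res Z C) = C"
  proof
    fix C assume C: "C \<in> {C \<in> full E L. sv_le G C}"
    have "sv_comp G (res Z C) e = C e" for e
      using C covector_off[of C e] Z[of e]
      by (auto simp: sv_comp_def res_def sv_le_def full_def)
    then show "sv_comp G (res Z C) = C" by (rule ext)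
  qed
  show "\<forall>T\<in>full Z (res Z ` L). res Z (sv_comp G T) = T"
    using Z by (auto simp: full_def res_def sv_comp_def fun_eq_iff)
  show "res Z ` {C \<in> full E L. sv_le G C} \<subseteq> full Z (res Z ` L)"
    using Z by (auto simp: full_def)
  show "sv_comp G ` full Z (res Z ` L) \<subseteq> {C \<in> full E L. sv_le G C}"
  proof (intro subsetI, elim imageE)
    fix C T assume T: "T \<in> full Z (res Z ` L)" and C: "C = sv_comp G T"
    obtain F where F: "F \<in> L" "T = res Z F" using T by (auto simp: full_def)
    have "sv_comp G T e = sv_comp G F e" for e
      using F Z[of e] covector_off[OF F(1), of e] by (auto simp: sv_comp_def res_def)
    then have "C = sv_comp G F" using C by auto
    then have "C \<in> L" using comp_covector assms(1) F by simp
    then show "C \<in> {C \<in> full E L. sv_le G C}"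
      using T Z C by (auto simp: full_def sv_le_def sv_comp_def)
  qed
qed

text \<open>Off \<open>Z\<close> the vector \<open>C\<close> agrees with \<open>G\<close>, and on
  \<open>Z\<close> the vector \<open>G\<close> separates nothing. The first summand is the distance
  from \<open>B\<close> to its gate \<open>sv_comp G B\<close>, the same for all \<open>C\<close> in
  the star.\<close>

lemma card_sep_star:
  assumes "G \<in> L" "B \<in> L" "sv_le G C" "C \<in> L"
  defines "Z \<equiv> zero_set E G"
  shows "card (sv_sep B C) = card (sv_sep B G) + card (sv_sep (res Z B) (res Z C))"
proof -
  have "e \<in> sv_sep B C \<longleftrightarrow> e \<in> sv_sep B G \<or> e \<in> sv_sep (res Z B) (res Z C)" for e
    using assms(3) covector_off[OF assms(2), of e]
    by (auto simp: sv_sep_def res_def sv_le_def Z_def zero_set_def)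
  then have "sv_sep B C = sv_sep B G \<union> sv_sep (res Z B) (res Z C)" by blast
  moreover have "sv_sep B G \<inter> sv_sep (res Z B) (res Z C) = {}"
    by (auto simp: sv_sep_def res_def Z_def zero_set_def)
  moreover have "finite (sv_sep B C)"
    using sv_sep_ground[OF assms(2)] finite_ground by (rule finite_subset)
  ultimately show ?thesis by (simp add: card_Un_disjoint)
qed

text \<open>A weighting is the signed sum of the weightings of the stars of the nonzero covectors \<open>G\<close>.
  The star of \<open>G\<close> is gated: distances to it split through \<open>sv_comp G B\<close>.\<close>

lemma weighting_step:
  fixes q :: "'k::field"
  assumes rs: "rank_sign (underlying_matroid E L) \<rho>" and one: "\<rho> {} = 1"
    and q: "q \<noteq> 0" "q ^ card E \<noteq> of_int (\<rho> E)"
    and m: "\<And>Y. Y \<subset> E \<Longrightarrow> has_weighting Y (res Y ` L) q (m Y)"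
  shows "has_weighting E L q ((\<Sum>Y | Y \<subset> E.
    of_nat (card {F \<in> L. zero_set E F = Y}) * (of_int (\<rho> Y) * m Y)) / (q ^ card E - of_int (\<rho> E)))"
proof -
  \<comment> \<open>The zero covector is left out because its star is the whole of
    \<open>full E L\<close>, for which no weighting is known yet. Its term in
    \<open>distance_sum\<close> is \<open>\<rho> E * q ^ 0\<close>, whence the constant
    \<open>d\<close>.\<close>
  define N where "N = {G \<in> L. zero_set E G \<subset> E}"
  define d where "d = q ^ card E - of_int (\<rho> E)"
  have d: "d \<noteq> 0" using q(2) by (simp add: d_def)
  have finN: "finite N" using finite_covectors by (simp add: N_def)
  have zero: "zero_set E G = E \<longleftrightarrow> G = (\<lambda>e. 0)" if "G \<in> L" for G
    using covector_off[OF that] by (auto simp: zero_set_def fun_eq_iff)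
  have L_eq: "L = insert (\<lambda>e. 0) N" "(\<lambda>e. 0) \<notin> N"
    using zero zero_covector by (auto simp: N_def zero_set_def)
  define good where "good Y w \<longleftrightarrow> (\<forall>B\<in>full Y (res Y ` L).
      (\<Sum>C\<in>full Y (res Y ` L). q ^ card (sv_sep B C) * w C) = 1) \<and>
      (\<Sum>C\<in>full Y (res Y ` L). w C) = m Y" for Y w
  have "\<forall>Y\<in>{Y. Y \<subset> E}. \<exists>w. good Y w"
    using m unfolding has_weighting_def good_def by blast
  from bchoice[OF this] obtain w where "\<forall>Y\<in>{Y. Y \<subset> E}. good Y (w Y)" ..
  then have w: "\<And>Y B. Y \<subset> E \<Longrightarrow> B \<in> full Y (res Y ` L) \<Longrightarrow>
        (\<Sum>C\<in>full Y (res Y ` L). q ^ card (sv_sep B C) * w Y C) = 1"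
      "\<And>Y. Y \<subset> E \<Longrightarrow> (\<Sum>C\<in>full Y (res Y ` L). w Y C) = m Y"
    by (simp_all add: good_def)
  define W where "W C = (\<Sum>G\<in>N. if sv_le G C
      then of_int (\<rho> (zero_set E G)) * w (zero_set E G) (res (zero_set E G) C) else 0) / d" for C
  have star: "(\<Sum>C\<in>full E L. if sv_le G C then f C else 0) =
      (\<Sum>T\<in>full (zero_set E G) (res (zero_set E G) ` L). g T)"
    if "G \<in> L" "\<And>C. C \<in> full E L \<Longrightarrow> sv_le G C \<Longrightarrow> f C = g (res (zero_set E G) C)"
    for G and f g :: "('a \<Rightarrow> int) \<Rightarrow> 'k"
  proof -
    have "(\<Sum>C\<in>full E L. if sv_le G C then f C else 0) =
        (\<Sum>C\<in>{C \<in> full E L. sv_le G C}. g (res (zero_set E G) C))"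
      using finite_full that(2) by (subst sum.inter_filter) (auto intro!: sum.cong)
    also have "\<dots> = (\<Sum>T\<in>full (zero_set E G) (res (zero_set E G) ` L). g T)"
      by (rule sum.reindex_bij_betw[OF star_bij[OF that(1)]])
    finally show ?thesis .
  qed
  have "(\<Sum>C\<in>full E L. q ^ card (sv_sep B C) * W C) = 1" if B: "B \<in> full E L" for B
  proof -
    have BL: "B \<in> L" using B by (simp add: full_def)
    have "(\<Sum>C\<in>full E L. q ^ card (sv_sep B C) * W C) =
        (\<Sum>C\<in>full E L. \<Sum>G\<in>N. if sv_le G C then q ^ card (sv_sep B C) *
          (of_int (\<rho> (zero_set E G)) * w (zero_set E G) (res (zero_set E G) C)) else 0) / d"
      unfolding W_def sum_divide_distrib sum_distrib_left by (intro sum.cong refl) auto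
    also have "\<dots> = (\<Sum>G\<in>N. \<Sum>C\<in>full E L. if sv_le G C then q ^ card (sv_sep B C) *
          (of_int (\<rho> (zero_set E G)) * w (zero_set E G) (res (zero_set E G) C)) else 0) / d"
      by (subst sum.swap) (rule refl)
    also have "\<dots> = (\<Sum>G\<in>N. of_int (\<rho> (zero_set E G)) * q ^ card (sv_sep B G)) / d"
    proof (intro arg_cong2[of _ _ _ _ "(/)"] refl sum.cong)
      fix G assume G: "G \<in> N"
      let ?Z = "zero_set E G"
      have GL: "G \<in> L" and Z: "?Z \<subset> E" using G by (auto simp: N_def)
      have BZ: "res ?Z B \<in> full ?Z (res ?Z ` L)"
        using B by (auto simp: full_def zero_set_def)
      have "(\<Sum>C\<in>full E L. if sv_le G C then q ^ card (sv_sep B C) *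
          (of_int (\<rho> ?Z) * w ?Z (res ?Z C)) else 0) =
          (\<Sum>T\<in>full ?Z (res ?Z ` L). (of_int (\<rho> ?Z) * q ^ card (sv_sep B G)) *
            (q ^ card (sv_sep (res ?Z B) T) * w ?Z T))"
      proof (rule star[OF GL])
        fix C assume "C \<in> full E L" "sv_le G C"
        then have "card (sv_sep B C) = card (sv_sep B G) + card (sv_sep (res ?Z B) (res ?Z C))"
          using card_sep_star[OF GL BL] by (simp add: full_def)
        then show "q ^ card (sv_sep B C) * (of_int (\<rho> ?Z) * w ?Z (res ?Z C)) =
            (of_int (\<rho> ?Z) * q ^ card (sv_sep B G)) *
            (q ^ card (sv_sep (res ?Z B) (res ?Z C)) * w ?Z (res ?Z C))"
          by (simp add: power_add algebra_simps)
      qed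
      also have "\<dots> = of_int (\<rho> ?Z) * q ^ card (sv_sep B G)"
        unfolding sum_distrib_left[symmetric] by (simp add: w(1)[OF Z BZ])
      finally show "(\<Sum>C\<in>full E L. if sv_le G C then q ^ card (sv_sep B C) *
          (of_int (\<rho> ?Z) * w ?Z (res ?Z C)) else 0) = of_int (\<rho> ?Z) * q ^ card (sv_sep B G)" .
    qed
    also have "(\<Sum>G\<in>N. of_int (\<rho> (zero_set E G)) * q ^ card (sv_sep B G)) = d"
    proof -
      have "sv_sep B (\<lambda>e. 0) = {}" by (auto simp: sv_sep_def)
      moreover have "zero_set E (\<lambda>e. 0) = E" by (auto simp: zero_set_def)
      ultimately show ?thesis
        using distance_sum[OF rs B q(1)] finN L_eq(2) one
        by (subst (asm) L_eq(1)) (simp add: d_def algebra_simps)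
    qed
    finally show ?thesis using d by simp
  qed
  moreover have "(\<Sum>C\<in>full E L. W C) = (\<Sum>Y | Y \<subset> E.
      of_nat (card {F \<in> L. zero_set E F = Y}) * (of_int (\<rho> Y) * m Y)) / d"
  proof -
    have "(\<Sum>C\<in>full E L. W C) = (\<Sum>G\<in>N. \<Sum>C\<in>full E L. if sv_le G C
      then of_int (\<rho> (zero_set E G)) * w (zero_set E G) (res (zero_set E G) C) else 0) / d"
      unfolding W_def sum_divide_distrib[symmetric] by (subst sum.swap) (rule refl)
    also have "\<dots> = (\<Sum>G\<in>N. of_int (\<rho> (zero_set E G)) * m (zero_set E G)) / d"
    proof (intro arg_cong2[of _ _ _ _ "(/)"] refl sum.cong)
      fix G assume "G \<in> N"
      then have G: "G \<in> L" "zero_set E G \<subset> E" by (auto simp: N_def)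
      show "(\<Sum>C\<in>full E L. if sv_le G C
          then of_int (\<rho> (zero_set E G)) * w (zero_set E G) (res (zero_set E G) C) else 0) =
          of_int (\<rho> (zero_set E G)) * m (zero_set E G)"
        unfolding w(2)[OF G(2), symmetric] sum_distrib_left by (rule star[OF G(1)]) simp
    qed
    also have "(\<Sum>G\<in>N. of_int (\<rho> (zero_set E G)) * m (zero_set E G)) =
        (\<Sum>Y | Y \<subset> E. \<Sum>G | G \<in> N \<and> zero_set E G = Y.
          of_int (\<rho> (zero_set E G)) * m (zero_set E G))"
    proof (rule sum.group[symmetric])
      show "finite {Y. Y \<subset> E}"
        by (rule finite_subset[of _ "Pow E"]) (use finite_ground in auto)
    qed (use finN in \<open>auto simp: N_def\<close>)
    also have "\<dots> = (\<Sum>Y | Y \<subset> E.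
        of_nat (card {F \<in> L. zero_set E F = Y}) * (of_int (\<rho> Y) * m Y))"
    proof (intro sum.cong refl)
      fix Y assume "Y \<in> {Y. Y \<subset> E}"
      then have "{G. G \<in> N \<and> zero_set E G = Y} = {F \<in> L. zero_set E F = Y}"
        by (auto simp: N_def)
      then show "(\<Sum>G | G \<in> N \<and> zero_set E G = Y. of_int (\<rho> (zero_set E G)) * m (zero_set E G)) =
          of_nat (card {F \<in> L. zero_set E F = Y}) * (of_int (\<rho> Y) * m Y)"
        by simp
    qed
    finally show ?thesis .
  qed
  ultimately show ?thesis unfolding has_weighting_def d_def by blast
qed

end

text \<open>In \<open>weighting_step\<close> the new total depends only on \<open>\<rho>\<close>,
  the zero set counts and the smaller totals, which by induction are common to both sides. The
  condition on the powers of \<open>q\<close> keeps every divisor nonzero.\<close>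

lemma common_weighting:
  fixes q :: "'k::field"
  assumes "oriented_matroid E L" "rank_sign (underlying_matroid E L) \<rho>"
    and "oriented_matroid E L'" "rank_sign (underlying_matroid E L') \<rho>"
    and one: "\<rho> {} = 1"
    and q: "q \<noteq> 0" "\<And>n c. n > 0 \<Longrightarrow> q ^ n \<noteq> of_int c"
    and "A \<subseteq> E"
  shows "\<exists>m. has_weighting A (res A ` L) q m \<and> has_weighting A (res A ` L') q m"
proof -
  interpret L: oriented_matroid E L by fact
  interpret L': oriented_matroid E L' by fact
  have "finite A" using \<open>A \<subseteq> E\<close> L.finite_ground by (rule finite_subset)
  then show ?thesis using \<open>A \<subseteq> E\<close>
  proof (induction A rule: finite_psubset_induct)
    case (psubset A)
    show ?case
    proof (cases "A = {}")
      case True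
      \<comment> \<open>The empty ground set has a single vertex of weight \<open>1\<close>. The
        recursion cannot start lower: here its divisor would be
        \<open>q ^ 0 - \<rho> {} = 0\<close>.\<close>
      have "has_weighting {} {\<lambda>e. 0} q 1"
        unfolding has_weighting_def by (rule exI[of _ "\<lambda>C. 1"]) (simp add: full_def sv_sep_def)
      moreover have "res A ` L = {\<lambda>e. 0}" "res A ` L' = {\<lambda>e. 0}"
        using True L.zero_covector L'.zero_covector by auto
      ultimately show ?thesis using True by auto
    next
      case False
      interpret LA: oriented_matroid A "res A ` L" by (rule L.oriented_matroid_res) fact
      interpret LA': oriented_matroid A "res A ` L'" by (rule L'.oriented_matroid_res) fact
      have rs: "rank_sign (underlying_matroid A (res A ` L)) \<rho>"
          "rank_sign (underlying_matroid A (res A ` L')) \<rho>"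
        using rank_sign_res assms(2,4) psubset.prems by auto
      obtain m where "\<forall>Y\<in>{Y. Y \<subset> A}. has_weighting Y (res Y ` L) q (m Y) \<and>
          has_weighting Y (res Y ` L') q (m Y)"
        using psubset by (metis (mono_tags, lifting) mem_Collect_eq order.trans psubset_imp_subset)
      then have m: "has_weighting Y (res Y ` res A ` L) q (m Y)"
          "has_weighting Y (res Y ` res A ` L') q (m Y)" if "Y \<subset> A" for Y
        using that by auto
      have qA: "q ^ card A \<noteq> of_int (\<rho> A)"
        using False psubset.hyps by (intro q(2)) (simp add: card_gt_0_iff)
      have "\<rho> Y \<noteq> 0" if "Y \<subseteq> A" for Y
        using rank_sign_unit[OF rs(1) one, of Y] that finite_subset[OF that psubset.hyps(1)]
        by (auto simp: underlying_matroid_def)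
      then have "card {F \<in> res A ` L. zero_set A F = Y} = card {F \<in> res A ` L'. zero_set A F = Y}"
        if "Y \<subset> A" for Y
        using zero_set_count_eq[OF LA.oriented_matroid_axioms rs(1) LA'.oriented_matroid_axioms rs(2)] that
        by blast
      then have "(\<Sum>Y | Y \<subset> A. of_nat (card {F \<in> res A ` L. zero_set A F = Y}) * (of_int (\<rho> Y) * m Y)) =
          (\<Sum>Y | Y \<subset> A. of_nat (card {F \<in> res A ` L'. zero_set A F = Y}) * (of_int (\<rho> Y) * m Y))"
        by (intro sum.cong) auto
      then show ?thesis
        using LA.weighting_step[OF rs(1) one q(1) qA m(1)] LA'.weighting_step[OF rs(2) one q(1) qA m(2)]
        by auto
    qed
  qed
qed


section \<open>The tope graph\<close>

context simple_oriented_matroid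
begin

lemma nonloop:
  assumes "e \<in> E"
  shows "\<exists>X\<in>L. X e \<noteq> 0"
proof -
  let ?M = "underlying_matroid E L"
  have indep0: "matroid_indep ?M D" if "D \<subset> {e}" for D
    using that by (auto simp: matroid_indep_def)
  have "\<not> matroid_circuit ?M {e}"
    using simple_underlying by (simp add: simple_matroid_def matroid_loop_def)
  then have "matroid_indep ?M {e}"
    using assms indep0 by (auto simp: matroid_circuit_def underlying_matroid_def)
  then show ?thesis
    using assms by (auto simp: matroid_indep_def matroid_closure_def underlying_matroid_def zero_set_def)
qed

lemma nonparallel:
  assumes "e \<in> E" "f \<in> E" "e \<noteq> f"
  shows "\<exists>X\<in>L. X e = 0 \<and> X f \<noteq> 0"
proof -
  let ?M = "underlying_matroid E L"
  have indep1: "matroid_indep ?M {g}" if "g \<in> E" for g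
    using nonloop[OF that] that
    by (auto simp: matroid_indep_def matroid_closure_def underlying_matroid_def zero_set_def)
  have indep: "matroid_indep ?M D" if "D \<subset> {e, f}" for D
  proof -
    have "D = {} \<or> D = {e} \<or> D = {f}" using that by auto
    then show ?thesis using indep1 assms by (auto simp: matroid_indep_def)
  qed
  have "\<not> matroid_circuit ?M {e, f}"
    using simple_underlying assms(3) unfolding simple_matroid_def matroid_parallel_def by blast
  then have "matroid_indep ?M {e, f}"
    using assms indep by (auto simp: matroid_circuit_def underlying_matroid_def)
  then have "f \<notin> matroid_closure ?M ({e, f} - {f})" by (simp add: matroid_indep_def)
  then show ?thesis
    using assms by (auto simp: matroid_closure_def underlying_matroid_def zero_set_def)
qed

text \<open>A tope with a zero at \<open>e\<close> could be enlarged by composing it with a covector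
  that is nonzero at \<open>e\<close>, which exists since \<open>e\<close> is not a loop.\<close>

lemma topes_eq_full: "topes L = full E L"
proof (intro equalityI subsetI)
  fix T assume T: "T \<in> topes L"
  then have TL: "T \<in> L" by (simp add: topes_def)
  have "T e \<noteq> 0" if "e \<in> E" for e
  proof -
    obtain X where X: "X \<in> L" "X e \<noteq> 0" using nonloop \<open>e \<in> E\<close> by blast
    have "sv_le T (sv_comp T X)" by (auto simp: sv_le_def sv_comp_def)
    then have "sv_comp T X = T" using T comp_covector[OF TL X(1)] by (simp add: topes_def)
    then have "sv_comp T X e = T e" by simp
    then show ?thesis using X(2) by (auto simp: sv_comp_def split: if_splits)
  qed
  then show "T \<in> full E L" using TL by (simp add: full_def)
next
  fix T assume T: "T \<in> full E L"
  have "X = T" if "X \<in> L" "sv_le T X" for X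
  proof
    show "X e = T e" for e
      using that T covector_off[of X e] covector_off[of T e]
      by (cases "e \<in> E") (auto simp: sv_le_def full_def)
  qed
  then show "T \<in> topes L" using T by (auto simp: topes_def full_def)
qed

lemma differ_eq_sep:
  assumes "B \<in> full E L" "C \<in> full E L"
  shows "{e. B e \<noteq> C e} = sv_sep B C"
proof -
  have "B e \<noteq> C e \<longleftrightarrow> B e = - C e \<and> B e \<noteq> 0" for e
    using assms covector_values[of B e] covector_values[of C e] covector_off[of B e] covector_off[of C e]
    by (cases "e \<in> E") (auto simp: full_def)
  then show ?thesis by (auto simp: sv_sep_def)
qed

text \<open>Take \<open>D \<noteq> B\<close> with a minimal separation from \<open>B\<close> inside \<open>sv_sep B C\<close>.  If it had two elements
  \<open>e\<close> and \<open>f\<close>, then eliminating \<open>e\<close> between \<open>B\<close> and \<open>D\<close> would give, by minimality, the covector that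
  agrees with \<open>B\<close> except that it vanishes on the separation, and perturbing it by a covector that
  vanishes at \<open>e\<close> but not at \<open>f\<close> would give a smaller separation.\<close>

lemma wall_towards:
  assumes B: "B \<in> full E L" and C: "C \<in> full E L" and "B \<noteq> C"
  shows "\<exists>D\<in>full E L. \<exists>e\<in>sv_sep B C. sv_sep B D = {e}"
proof -
  have BL: "B \<in> L" and Bnz: "\<And>e. e \<in> E \<Longrightarrow> B e \<noteq> 0" using B by (auto simp: full_def)
  define P where "P D \<longleftrightarrow> D \<in> full E L \<and> sv_sep B D \<noteq> {} \<and> sv_sep B D \<subseteq> sv_sep B C" for D
  have "sv_sep B C \<noteq> {}" using differ_eq_sep[OF B C] \<open>B \<noteq> C\<close> by auto
  then have "P C" using C by (simp add: P_def)
  then obtain D where PD: "P D" and min: "\<And>D'. P D' \<Longrightarrow> card (sv_sep B D) \<le> card (sv_sep B D')"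
    using ex_has_least_nat[of P C "\<lambda>D. card (sv_sep B D)"] by blast
  let ?S = "sv_sep B D"
  have D: "D \<in> full E L" and DL: "D \<in> L" and SC: "?S \<subseteq> sv_sep B C" "?S \<noteq> {}"
    using PD by (auto simp: P_def full_def)
  have SE: "?S \<subseteq> E" by (rule sv_sep_ground[OF BL])
  have fin: "finite ?S" using SE finite_ground by (rule finite_subset)
  have minimal: "sv_sep B D' = ?S" if "D' \<in> full E L" "sv_sep B D' \<noteq> {}" "sv_sep B D' \<subseteq> ?S" for D'
  proof -
    have "P D'" using that SC by (auto simp: P_def)
    then show ?thesis using card_seteq[OF fin that(3)] min by blast
  qed
  have comp_full: "sv_comp X T \<in> full E L" if "X \<in> L" "T \<in> full E L" for X T
    using that comp_covector by (auto simp: full_def sv_comp_def)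
  have off: "D g = B g" if "g \<notin> ?S" for g
    using that unfolding differ_eq_sep[OF B D, symmetric] by simp
  have sep_subset: "sv_sep B T \<subseteq> ?S" if "\<And>g. g \<notin> ?S \<Longrightarrow> T g = B g" for T
  proof
    fix g assume g: "g \<in> sv_sep B T"
    show "g \<in> ?S"
    proof (rule ccontr)
      assume "g \<notin> ?S"
      then have "T g = B g" by (rule that)
      with g show False by (auto simp: sv_sep_def)
    qed
  qed
  obtain e where e: "e \<in> ?S" using SC by auto
  have "?S = {e}"
  proof (rule ccontr)
    assume "?S \<noteq> {e}"
    then obtain f where f: "f \<in> ?S" "f \<noteq> e" using e by auto
    obtain Z where Z: "Z \<in> L" "Z e = 0" "\<forall>g\<in>E - ?S. Z g = sv_comp B D g"
      using strong_elim BL DL e by blast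
    have Zoff: "Z g = B g" if "g \<notin> ?S" for g
      using that Z(3) Bnz off[OF that] covector_off[OF Z(1), of g] covector_off[OF BL, of g]
      by (cases "g \<in> E") (auto simp: sv_comp_def)
    have "sv_sep B (sv_comp Z B) \<subseteq> ?S"
      by (rule sep_subset) (simp add: sv_comp_def Zoff)
    moreover have "e \<notin> sv_sep B (sv_comp Z B)"
      using Z(2) by (auto simp: sv_sep_def sv_comp_def)
    ultimately have "sv_sep B (sv_comp Z B) = {}"
      using minimal[OF comp_full[OF Z(1) B]] e by auto
    then have "sv_comp Z B g = B g" for g
      using differ_eq_sep[OF B comp_full[OF Z(1) B]] by simp
    then have ZB: "Z g = 0 \<or> Z g = B g" for g
      unfolding sv_comp_def by metis
    have "sv_sep B (sv_comp Z D) \<subseteq> ?S"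
      by (rule sep_subset) (simp add: sv_comp_def Zoff off)
    moreover have "e \<in> sv_sep B (sv_comp Z D)"
      using e Z(2) by (auto simp: sv_sep_def sv_comp_def)
    ultimately have eqS: "sv_sep B (sv_comp Z D) = ?S"
      using minimal[OF comp_full[OF Z(1) D]] by auto
    have Z0: "Z g = 0" if "g \<in> ?S" for g
    proof (rule ccontr)
      assume "Z g \<noteq> 0"
      then have "sv_comp Z D g = B g" using ZB[of g] by (auto simp: sv_comp_def)
      then have "g \<notin> sv_sep B (sv_comp Z D)" by (auto simp: sv_sep_def)
      with eqS that show False by simp
    qed
    obtain X where X: "X \<in> L" "X e = 0" "X f \<noteq> 0"
      using nonparallel[of e f] e f SE by blast
    define X' where "X' = (if X f = D f then X else (\<lambda>g. - X g))"
    have X': "X' \<in> L" "X' e = 0" using X neg_covector by (auto simp: X'_def)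
    have "D f \<noteq> 0" using f SE D by (auto simp: full_def)
    then have "X' f = D f"
      using X(3) covector_values[OF X(1), of f] covector_values[OF DL, of f] by (auto simp: X'_def)
    define T where "T = sv_comp (sv_comp Z X') B"
    have T: "T \<in> full E L" unfolding T_def by (intro comp_full comp_covector Z(1) X'(1) B)
    have "T f = D f" using Z0[OF f(1)] \<open>X' f = D f\<close> \<open>D f \<noteq> 0\<close> by (simp add: T_def sv_comp_def)
    then have "f \<in> sv_sep B T" using f(1) by (simp add: sv_sep_def)
    moreover have "T e = B e" using Z(2) X'(2) by (simp add: T_def sv_comp_def)
    then have "e \<notin> sv_sep B T" by (auto simp: sv_sep_def)
    moreover have "sv_sep B T \<subseteq> ?S"
      by (rule sep_subset) (use Bnz covector_off[OF X'(1)] in \<open>auto simp: T_def sv_comp_def Zoff\<close>)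
    ultimately show False using minimal[OF T] e by auto
  qed
  with e D SC show ?thesis by blast
qed

lemma graph_dist_tope_graph:
  assumes "B \<in> full E L" "C \<in> full E L"
  shows "graph_dist (tope_graph L) B C = card (sv_sep B C)"
proof -
  let ?R = "snd (tope_graph L)"
  have R: "(B, C) \<in> ?R \<longleftrightarrow> B \<in> full E L \<and> C \<in> full E L \<and> card (sv_sep B C) = 1" for B C
    using differ_eq_sep by (auto simp: tope_graph_def topes_eq_full)
  have fin: "finite {e. B e \<noteq> C e}" if "B \<in> full E L" "C \<in> full E L" for B C
    using differ_eq_sep[OF that] sv_sep_ground[of B] that finite_ground
    by (auto simp: full_def intro: finite_subset)
  have reach: "(B, C) \<in> ?R ^^ card (sv_sep B C)" if "B \<in> full E L" for B
    using that
  proof (induction "card (sv_sep B C)" arbitrary: B)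
    case 0
    then have "B = C" using differ_eq_sep[OF 0(2) assms(2)] fin[OF 0(2) assms(2)] by auto
    then show ?case using 0 by simp
  next
    case (Suc n)
    then have "B \<noteq> C" by (auto simp: sv_sep_def)
    then obtain D e where D: "D \<in> full E L" "e \<in> sv_sep B C" "sv_sep B D = {e}"
      using wall_towards[OF Suc.prems assms(2)] by blast
    have BD: "{g. B g \<noteq> D g} = {e}" using differ_eq_sep[OF Suc.prems D(1)] D(3) by simp
    have "e \<in> sv_sep B D" using D(3) by simp
    then have De: "D e = C e" using D(2) by (simp add: sv_sep_def)
    have "D g \<noteq> C g \<longleftrightarrow> B g \<noteq> C g \<and> g \<noteq> e" for g
    proof (cases "g = e")
      case False
      then have "g \<notin> {g. B g \<noteq> D g}" unfolding BD by simp
      with False show ?thesis by simp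
    qed (simp add: De)
    then have "{g. D g \<noteq> C g} = {g. B g \<noteq> C g} - {e}" by blast
    then have "sv_sep D C = sv_sep B C - {e}"
      using differ_eq_sep Suc.prems D(1) assms(2) by simp
    then have "n = card (sv_sep D C)" using Suc.hyps(2) D(2) by simp
    with Suc.hyps(1) D(1) have "(D, C) \<in> ?R ^^ n" by blast
    moreover have "(B, D) \<in> ?R" using R Suc.prems D by simp
    ultimately have "(B, C) \<in> ?R ^^ Suc n" by (rule relpow_Suc_I2[rotated])
    then show ?case using Suc.hyps(2) by simp
  qed
  have lower: "card {e. B e \<noteq> C e} \<le> n" if "(B, C) \<in> ?R ^^ n" "B \<in> full E L" for n B
    using that
  proof (induction n arbitrary: B)
    case (Suc n)
    then obtain D where D: "(B, D) \<in> ?R" "(D, C) \<in> ?R ^^ n" by (meson relpow_Suc_D2)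
    then have BD: "D \<in> full E L" "card {e. B e \<noteq> D e} = 1" using R differ_eq_sep by auto
    have "card {e. B e \<noteq> C e} \<le> card ({e. B e \<noteq> D e} \<union> {e. D e \<noteq> C e})"
      by (rule card_mono) (use fin Suc.prems(2) BD(1) assms(2) in auto)
    also have "\<dots> \<le> card {e. B e \<noteq> D e} + card {e. D e \<noteq> C e}" by (rule card_Un_le)
    also have "\<dots> \<le> Suc n" using BD Suc.IH[OF D(2)] by simp
    finally show ?case .
  qed simp
  show ?thesis unfolding graph_dist_def
    by (rule Least_equality) (use reach lower differ_eq_sep assms in auto)
qed

end


section \<open>Magnitude from a weighting\<close>

lemma inverse_exists:
  fixes P :: "'v \<Rightarrow> 'v \<Rightarrow> 'k::field poly"
  assumes "finite V" "\<And>u v. u \<in> V \<Longrightarrow> v \<in> V \<Longrightarrow> poly (P u v) 0 = (if u = v then 1 else 0)"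
  shows "\<exists>B. is_inverse_on V (\<lambda>u v. to_fract (P u v)) B"
proof -
  obtain h where h: "bij_betw h {0..<card V} V" using ex_bij_betw_nat_finite assms(1) by blast
  define n where "n = card V"
  define k where "k = inv_into {0..<n} h"
  have k: "k u < n" "h (k u) = u" if "u \<in> V" for u
    using h that bij_betw_inv_into[OF h] bij_betw_inv_into_right[OF h that]
    by (auto simp: k_def n_def bij_betw_def)
  have kh: "k (h i) = i" if "i < n" for i
    using h that by (simp add: k_def n_def bij_betw_inv_into_left)
  have hV: "h i \<in> V" if "i < n" for i using h that by (auto simp: n_def bij_betw_def)
  define M where "M = mat n n (\<lambda>(i, j). P (h i) (h j))"
  define K where "K = map_mat to_fract M"
  interpret tf: comm_ring_hom "to_fract :: 'k poly \<Rightarrow> 'k poly fract" by unfold_locales auto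
  interpret ev: comm_ring_hom "\<lambda>p :: 'k poly. poly p 0" by unfold_locales auto
  have "poly (det M) 0 = det (map_mat (\<lambda>p. poly p 0) M)" by (rule ev.hom_det[symmetric])
  also have "map_mat (\<lambda>p. poly p 0) M = 1\<^sub>m n"
    by (rule eq_matI) (use assms(2) hV kh in \<open>auto simp: M_def, metis\<close>)
  finally have "det M \<noteq> 0" by auto
  then have "det K \<noteq> 0" by (simp add: K_def)
  moreover have K: "K \<in> carrier_mat n n" by (simp add: K_def M_def)
  ultimately have "K \<in> Units (ring_mat TYPE('k poly fract) n ())" by (intro det_non_zero_imp_unit)
  then obtain N where N: "N \<in> carrier_mat n n" "N * K = 1\<^sub>m n" "K * N = 1\<^sub>m n"
    by (auto simp: Units_def ring_mat_def)
  have entry: "K $$ (k u, k v) = to_fract (P u v)" if "u \<in> V" "v \<in> V" for u v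
    using k that by (simp add: K_def M_def)
  have sum_eq: "(\<Sum>v\<in>V. f v) = (\<Sum>i = 0..<n. f (h i))" for f :: "'v \<Rightarrow> 'k poly fract"
    using sum.reindex_bij_betw[OF h, of f] by (simp add: n_def)
  have mult: "(\<Sum>v\<in>V. A $$ (k u, k v) * B $$ (k v, k w)) = (A * B) $$ (k u, k w)"
    if "A \<in> carrier_mat n n" "B \<in> carrier_mat n n" "u \<in> V" "w \<in> V" for A B :: "'k poly fract mat" and u w
    using that k kh by (simp add: sum_eq scalar_prod_def)
  have one: "1\<^sub>m n $$ (k u, k w) = (if u = w then 1 else (0 :: 'k poly fract))" if "u \<in> V" "w \<in> V" for u w
    using k that by auto metis
  show ?thesis
  proof (intro exI[of _ "\<lambda>u v. N $$ (k u, k v)"], unfold is_inverse_on_def, intro conjI ballI)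
    fix u w assume uw: "u \<in> V" "w \<in> V"
    show "(\<Sum>v\<in>V. to_fract (P u v) * N $$ (k v, k w)) = (if u = w then 1 else 0)"
      using mult[OF K N(1) uw] one[OF uw] uw by (simp add: entry N(3))
    show "(\<Sum>v\<in>V. N $$ (k u, k v) * to_fract (P v w)) = (if u = w then 1 else 0)"
      using mult[OF N(1) K uw] one[OF uw] uw by (simp add: entry N(2))
  qed
qed

lemma mag_q_power: "mag_q ^ n = to_fract (monom 1 n)"
  by (induction n) (simp_all add: mag_q_def monom_Suc flip: to_fract_mult)

lemma of_int_fract: "of_int c = to_fract (of_int c :: 'a::idom)"
proof -
  have "of_nat n = to_fract (of_nat n :: 'a)" for n by (induction n) simp_all
  then show ?thesis by (cases c rule: int_cases2) simp_all
qed

lemma mag_q_power_neq_of_int: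
  assumes "n > 0"
  shows "mag_q ^ n \<noteq> of_int c"
proof
  assume "mag_q ^ n = of_int c"
  then have "monom 1 n = (of_int c :: rat poly)" by (simp add: mag_q_power of_int_fract)
  then have "coeff (monom (1 :: rat) n) n = coeff (of_int c) n" by simp
  then show False using assms by (simp add: of_int_poly coeff_pCons split: nat.splits)
qed

context simple_oriented_matroid
begin

lemma magnitude_eq_weighting:
  assumes "has_weighting E L mag_q m"
  shows "magnitude (tope_graph L) = m"
proof -
  let ?V = "full E L" and ?K = "similarity_matrix (tope_graph L)"
  let ?I = "inverse_on ?V ?K"
  have K: "?K B C = mag_q ^ card (sv_sep B C)" if "B \<in> ?V" "C \<in> ?V" for B C
    using graph_dist_tope_graph[OF that] by (simp add: similarity_matrix_def)
  have "\<exists>I. is_inverse_on ?V (\<lambda>B C. to_fract (monom (1 :: rat) (card (sv_sep B C)))) I"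
  proof (rule inverse_exists[where P = "\<lambda>B C. monom 1 (card (sv_sep B C))", OF finite_full])
    fix B C assume BC: "B \<in> ?V" "C \<in> ?V"
    have "finite (sv_sep B C)"
      using sv_sep_ground BC finite_ground by (auto simp: full_def intro: finite_subset)
    then have "card (sv_sep B C) = 0 \<longleftrightarrow> B = C"
      using differ_eq_sep[OF BC] by auto
    then show "poly (monom (1 :: rat) (card (sv_sep B C))) 0 = (if B = C then 1 else 0)"
      by (auto simp: poly_monom power_0_left)
  qed
  then have "\<exists>I. is_inverse_on ?V ?K I"
    unfolding is_inverse_on_def by (simp add: K mag_q_power)
  then have inv: "is_inverse_on ?V ?K ?I" unfolding inverse_on_def by (rule someI_ex)
  obtain w where w: "\<And>B. B \<in> ?V \<Longrightarrow> (\<Sum>C\<in>?V. ?K B C * w C) = 1" "(\<Sum>C\<in>?V. w C) = m"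
    using assms K unfolding has_weighting_def by (metis (no_types, lifting) sum.cong)
  have "magnitude (tope_graph L) = (\<Sum>A\<in>?V. \<Sum>B\<in>?V. ?I A B * (\<Sum>C\<in>?V. ?K B C * w C))"
    using w(1) by (simp add: magnitude_def tope_graph_def topes_eq_full)
  also have "\<dots> = (\<Sum>A\<in>?V. \<Sum>C\<in>?V. (\<Sum>B\<in>?V. ?I A B * ?K B C) * w C)"
    unfolding sum_distrib_left sum_distrib_right
    by (rule sum.cong[OF refl], subst sum.swap) (simp add: mult.assoc)
  also have "\<dots> = (\<Sum>A\<in>?V. \<Sum>C\<in>?V. if A = C then w C else 0)"
    using inv unfolding is_inverse_on_def by (intro sum.cong refl) simp
  also have "\<dots> = m"
    using w(2) finite_full by simp
  finally show ?thesis .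
qed

end

theorem corollary3p6:
  fixes E E' :: "'a set" and L L' :: "('a \<Rightarrow> int) set"
  assumes "simple_oriented_matroid E L"
    and "simple_oriented_matroid E' L'"
    and "underlying_matroid E L = underlying_matroid E' L'"
  shows "magnitude (tope_graph L) = magnitude (tope_graph L')"
proof -
  interpret A: simple_oriented_matroid E L by fact
  have "E' = E" using assms(3) by (simp add: underlying_matroid_def)
  interpret B: simple_oriented_matroid E L' using assms(2) \<open>E' = E\<close> by simp
  obtain \<rho> where \<rho>: "rank_sign (underlying_matroid E L) \<rho>" "\<rho> {} = 1"
    using A.rank_sign_exists by blast
  have \<rho>': "rank_sign (underlying_matroid E L') \<rho>" using \<rho>(1) assms(3) \<open>E' = E\<close> by simp
  have q: "mag_q \<noteq> 0" by (simp add: mag_q_def)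
  obtain m where "has_weighting E (res E ` L) mag_q m" "has_weighting E (res E ` L') mag_q m"
    using common_weighting[OF A.oriented_matroid_axioms \<rho>(1) B.oriented_matroid_axioms \<rho>' \<rho>(2) q
        mag_q_power_neq_of_int order_refl] by blast
  then show ?thesis
    using A.magnitude_eq_weighting B.magnitude_eq_weighting
    by (simp add: A.res_image_ground B.res_image_ground)
qed

end
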